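(* Let $A,B\subseteq\mathcal{V}_{w,\infty}$ and $\mathcal{A}\subseteq\mathfrak{P}(\mathcal{V}_{w,\infty})$. Then the following statements hold. 1. $\mathfrak{K}_{\bigcup\mathcal{A}}=\sup_{A\in\mathcal{A}}\mathfrak{K}_{A}$, where $\bigcup\mathcal{A}:=\bigcup_{A\in\mathcal{A}}A$. 2. $\mathfrak{K}_{A}=\mathfrak{K}_{\operatorname{cl}(A)}$. 3. $\mathfrak{K}_{\bullet}:\mathfrak{C}(\mathcal{V}_{w,\infty}\setminus\{0\})\to\mathcal{V}_{w^2,\infty}$ is continuous with respect to the Hausdorff metric. 4. $\mathfrak{K}_{\bullet}:\mathfrak{P}(\mathcal{V}_{w,\infty}\setminus B(0,r))\to\mathcal{V}_{w^2,\infty}$ is continuous with respect to the Hausdorff pseudometric for all $r>0$. 5. $\mathfrak{K}_{\bullet}:\operatorname{Cone}(\mathfrak{P}(\mathcal{V}_{w,\infty}))\to\mathcal{V}_{w^2,\infty}$ is continuous with respect to the truncated Hausdorff pseudometric. 6. If $A\perp B$, then $\mathfrak{K}_{A+B}\le\mathfrak{K}_{A}+\mathfrak{K}_{B}$. 7. $\mathfrak{K}_{A\oplus B}=\mathfrak{K}_{A}+\mathfrak{K}_{B}$. 8. If $A$ and $B$ are stochastically independent, then $\mathfrak{K}_{A\cdot B}=\mathfrak{K}_{A}\cdot\mathfrak{K}_{B}$. 9. $\mathfrak{K}_{A\otimes B}=\mathfrak{K}_{A}\cdot\mathfrak{K}_{B}$. Here the sum ($+$), the product ($\cdot$), the stochastic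 independence and the orthogonality ($\perp$) of sets have to be understood element-wise.
   Context: Let $\rho$ be a probability measure on $Y$, $\mathcal{V}=L^2(Y,\rho)$ and $\|\cdot\|=\|\cdot\|_{L^2(Y,\rho)}$. Let $w\ge0$ be a fixed weight function on $Y$ with $\int_Y w^{-1}\,d\rho=1$. Define $\|v\|_{w,\infty}:=\operatorname{ess\,sup}_{y\in Y}\sqrt{w(y)}\,|v(y)|$ and the normed space $\mathcal{V}_{w,\infty}:=\{v\in\mathcal{V}:\|v\|_{w,\infty}<\infty\}$; $\mathcal{V}_{w^2,\infty}$ is defined in the same way with $w$ replaced by $w^2$, so its norm is $\|v\|_{w^2,\infty}=\operatorname{ess\,sup}_{y\in Y}w(y)|v(y)|$. For a set $A$ of functions put $U(A):=\{u/\|u\| : u\in A\setminus\{0\}\}$. The variation function of $A$ is $\mathfrak{K}_A(y):=\sup_{a\in U(A)}|a(y)|^2$. $\mathfrak{P}(X)$ is the set of all subsets of $X$, $\mathfrak{C}(X)$ is the set of nonempty compact subsets of a metric space $X$, and $\operatorname{cl}$ denotes the closure (in $\mathcal{V}_{w,\infty}$). $B(0,r)$ and $S(0,1)$ denote the ball of radius $r$ and the unit sphere centered at $0$ with respect to $\|\cdot\|$. For a metric $d$, the Hausdorff distance is $d_{\mathrm H}(X,Z):=\max\{\sup_{x\in X}\inf_{z\in Z}d(x,z),\ \sup_{z\in Z}\inf_{x\in X}d(x,z)\}$, which is a metric on nonempty compact subsets and a pseudometric on all subsets; here $d$ is induced by $\|\cdot\|_{w,\infty}$. $\operatorname{Cone}(X):=\{\lambda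 x:\lambda>0,\ x\in X\}$, and $\operatorname{Cone}(\mathfrak{P}(\mathcal{V}_{w,\infty}))$ denotes the set of all cones in $\mathcal{V}_{w,\infty}$. The truncated Hausdorff pseudometric on cones is $d_{\mathrm{tH}}(X,Z):=d_{\mathrm H}(S(0,1)\cap X,\ S(0,1)\cap Z)$. Element-wise means: $A+B=\{a+b:a\in A,b\in B\}$ and $A\cdot B=\{ab:a\in A,b\in B\}$; $A\perp B$ means that every $a\in A$ is orthogonal in $L^2(Y,\rho)$ to every $b\in B$; $A$ and $B$ are stochastically independent if every $a\in A$ and every $b\in B$ are independent as random variables. The symbol $\oplus$ denotes the orthogonal direct sum and $\otimes$ the tensor product, whose elementary tensors $a\otimes b$ are the products of $a$ and $b$ taken in separate variables; the product $\mathfrak{K}_A\cdot\mathfrak{K}_B$ in statement 9 is taken in the same separate variables.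
   Formalization: Suprema are modulo null sets. In 3–5 the target is all measurable v with finite w²-norm, not only v in L²; 4 and 5 assert continuity on the open family of A with K_A in it; 7 assumes A⊥B, nonempty, closed under real scaling; 9 is for elementary tensors, and for spans of subspaces. *)

theory Defs
  imports
    "HOL-Probability.Probability"
    "HOL-Library.Function_Algebras"
    "HOL-Library.Set_Algebras"
begin

text \<open>
  Elements of \<open>L\<^sup>2(Y,\<rho>)\<close> are represented by measurable real functions on the probability space
  \<open>M = (Y,\<rho>)\<close>; equality of classes is equality almost everywhere. Sets of classes are represented
  by sets of functions, and none of the notions below depends on the representatives chosen,
  except up to equality almost everywhere.
\<close>

definition L2_space :: "'y measure \<Rightarrow> ('y \<Rightarrow> real) set" where
  "L2_space M = {v \<in> borel_measurable M. integrable M (\<lambda>y. (v y)\<^sup>2)}"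

definition L2_norm :: "'y measure \<Rightarrow> ('y \<Rightarrow> real) \<Rightarrow> real" where
  "L2_norm M v = sqrt (\<integral>y. (v y)\<^sup>2 \<partial>M)"

definition L2_nonzero :: "'y measure \<Rightarrow> ('y \<Rightarrow> real) set" where
  "L2_nonzero M = {v \<in> L2_space M. \<not> (AE y in M. v y = 0)}"

definition wnorm :: "'y measure \<Rightarrow> ('y \<Rightarrow> real) \<Rightarrow> ('y \<Rightarrow> real) \<Rightarrow> ennreal" where
  "wnorm M w v = esssup M (\<lambda>y. ennreal (sqrt (w y) * \<bar>v y\<bar>))"

definition wspace :: "'y measure \<Rightarrow> ('y \<Rightarrow> real) \<Rightarrow> ('y \<Rightarrow> real) set" where
  "wspace M w = {v \<in> L2_space M. wnorm M w v < \<infinity>}"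

text \<open>
  If \<open>\<integral> w\<^sup>-\<^sup>1 d\<rho> < \<infinity>\<close>, finiteness of \<open>wnorm M w v\<close> already forces \<open>v\<close> into \<open>L\<^sup>2\<close>, so that the space
  below coincides with \<open>wspace\<close> (lemma \<open>wspace_measurable_eq\<close>). This may fail for the weight
  \<open>w\<^sup>2\<close>: if \<open>\<integral> w\<^sup>-\<^sup>2 d\<rho> = \<infinity>\<close>, then \<open>a = w\<^sup>-\<^sup>1\<^sup>/\<^sup>2\<close> has \<open>wnorm M w a = 1\<close> and \<open>L2_norm M a = 1\<close>,
  but its squared modulus \<open>w\<^sup>-\<^sup>1\<close> is not in \<open>L\<^sup>2\<close>. The variation functions of sets in \<open>wspace M w\<close>
  are therefore regarded as elements of this space, for the weight \<open>w\<^sup>2\<close>.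
\<close>

definition wspace_measurable :: "'y measure \<Rightarrow> ('y \<Rightarrow> real) \<Rightarrow> ('y \<Rightarrow> real) set" where
  "wspace_measurable M w = {v \<in> borel_measurable M. wnorm M w v < \<infinity>}"

text \<open>
  The supremum of a possibly uncountable family of functions is taken in the lattice of measurable
  functions modulo equality almost everywhere: a pointwise supremum is not defined on classes.
\<close>

definition is_ess_Sup :: "'y measure \<Rightarrow> ('y \<Rightarrow> ennreal) set \<Rightarrow> ('y \<Rightarrow> ennreal) \<Rightarrow> bool" where
  "is_ess_Sup M F s \<longleftrightarrow> s \<in> borel_measurable M \<and>
     (\<forall>f\<in>F. AE y in M. f y \<le> s y) \<and>
     (\<forall>t\<in>borel_measurable M. (\<forall>f\<in>F. AE y in M. f y \<le> t y) \<longrightarrow> (AE y in M. s y \<le> t y))"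

definition ess_Sup :: "'y measure \<Rightarrow> ('y \<Rightarrow> ennreal) set \<Rightarrow> 'y \<Rightarrow> ennreal" where
  "ess_Sup M F = (SOME s. is_ess_Sup M F s)"

definition normalized :: "'y measure \<Rightarrow> ('y \<Rightarrow> real) set \<Rightarrow> ('y \<Rightarrow> real) set" where
  "normalized M A = {\<lambda>y. u y / L2_norm M u | u. u \<in> A \<and> \<not> (AE y in M. u y = 0)}"

definition variation :: "'y measure \<Rightarrow> ('y \<Rightarrow> real) set \<Rightarrow> 'y \<Rightarrow> ennreal" where
  "variation M A = ess_Sup M ((\<lambda>a y. ennreal (\<bar>a y\<bar>\<^sup>2)) ` normalized M A)"

text \<open>
  The real-valued version, meaningful where \<open>variation M A\<close> is finite almost everywhere.
\<close>

definition real_variation :: "'y measure \<Rightarrow> ('y \<Rightarrow> real) set \<Rightarrow> 'y \<Rightarrow> real" where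
  "real_variation M A = (\<lambda>y. enn2real (variation M A y))"

definition has_finite_variation :: "'y measure \<Rightarrow> ('y \<Rightarrow> real) \<Rightarrow> ('y \<Rightarrow> real) set \<Rightarrow> bool" where
  "has_finite_variation M w A \<longleftrightarrow> (AE y in M. variation M A y < \<infinity>) \<and>
     real_variation M A \<in> wspace_measurable M (\<lambda>y. (w y)\<^sup>2)"

definition pseudometric_topology :: "'x set \<Rightarrow> ('x \<Rightarrow> 'x \<Rightarrow> ennreal) \<Rightarrow> 'x topology" where
  "pseudometric_topology S d = topology_generated_by {{y\<in>S. d x y < e} | x e. x \<in> S \<and> 0 < e}"

definition wdist :: "'y measure \<Rightarrow> ('y \<Rightarrow> real) \<Rightarrow> ('y \<Rightarrow> real) \<Rightarrow> ('y \<Rightarrow> real) \<Rightarrow> ennreal" where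
  "wdist M w u v = wnorm M w (u - v)"

definition wtopology :: "'y measure \<Rightarrow> ('y \<Rightarrow> real) \<Rightarrow> ('y \<Rightarrow> real) topology" where
  "wtopology M w = pseudometric_topology (wspace M w) (wdist M w)"

definition wtopology_measurable :: "'y measure \<Rightarrow> ('y \<Rightarrow> real) \<Rightarrow> ('y \<Rightarrow> real) topology" where
  "wtopology_measurable M w = pseudometric_topology (wspace_measurable M w) (wdist M w)"

text \<open>
  In \<open>ennreal\<close> the supremum and infimum over the empty set are \<open>0\<close> and \<open>\<infinity>\<close>, so the distance
  of the empty set to itself is \<open>0\<close> and to any nonempty set \<open>\<infinity>\<close>.
\<close>

definition hausdorff_dist :: "('x \<Rightarrow> 'x \<Rightarrow> ennreal) \<Rightarrow> 'x set \<Rightarrow> 'x set \<Rightarrow> ennreal" where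
  "hausdorff_dist d X Z = max (SUP x\<in>X. INF z\<in>Z. d x z) (SUP z\<in>Z. INF x\<in>X. d x z)"

definition unit_sphere :: "'y measure \<Rightarrow> ('y \<Rightarrow> real) set" where
  "unit_sphere M = {v \<in> L2_space M. L2_norm M v = 1}"

definition open_ball0 :: "'y measure \<Rightarrow> real \<Rightarrow> ('y \<Rightarrow> real) set" where
  "open_ball0 M r = {v \<in> L2_space M. L2_norm M v < r}"

definition truncated_hausdorff_dist ::
    "'y measure \<Rightarrow> ('y \<Rightarrow> real) \<Rightarrow> ('y \<Rightarrow> real) set \<Rightarrow> ('y \<Rightarrow> real) set \<Rightarrow> ennreal" where
  "truncated_hausdorff_dist M w X Z =
     hausdorff_dist (wdist M w) (unit_sphere M \<inter> X) (unit_sphere M \<inter> Z)"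

definition fscale :: "real \<Rightarrow> ('y \<Rightarrow> real) \<Rightarrow> 'y \<Rightarrow> real" where
  "fscale c f = (\<lambda>y. c * f y)"

interpretation fun_space: vector_space "fscale :: real \<Rightarrow> ('y \<Rightarrow> real) \<Rightarrow> 'y \<Rightarrow> real"
  by standard (auto simp: fscale_def fun_eq_iff algebra_simps)

definition Cone :: "('y \<Rightarrow> real) set \<Rightarrow> ('y \<Rightarrow> real) set" where
  "Cone X = {fscale c x | c x. 0 < c \<and> x \<in> X}"

definition nonempty_compacts :: "'y measure \<Rightarrow> ('y \<Rightarrow> real) \<Rightarrow> ('y \<Rightarrow> real) set set" where
  "nonempty_compacts M w =
     {A. A \<noteq> {} \<and> compactin (subtopology (wtopology M w) (L2_nonzero M)) A}"

text \<open>
  Continuity of \<open>A \<mapsto> variation M A\<close> on a family \<open>D\<close> of sets with pseudometric \<open>d\<close>, where the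
  variation need not have finite norm for every member of \<open>D\<close>: the map is continuous on the
  members for which it takes values in the target space, and these form an open part of \<open>D\<close>.
\<close>

definition variation_continuous_on :: "'y measure \<Rightarrow> ('y \<Rightarrow> real) \<Rightarrow> ('y \<Rightarrow> real) set set \<Rightarrow>
    (('y \<Rightarrow> real) set \<Rightarrow> ('y \<Rightarrow> real) set \<Rightarrow> ennreal) \<Rightarrow> bool" where
  "variation_continuous_on M w D d \<longleftrightarrow>
     openin (pseudometric_topology D d) {A\<in>D. has_finite_variation M w A} \<and>
     continuous_map
       (subtopology (pseudometric_topology D d) {A\<in>D. has_finite_variation M w A})
       (wtopology_measurable M (\<lambda>y. (w y)\<^sup>2)) (real_variation M)"

definition orthogonal_sets :: "'y measure \<Rightarrow> ('y \<Rightarrow> real) set \<Rightarrow> ('y \<Rightarrow> real) set \<Rightarrow> bool" where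
  "orthogonal_sets M A B \<longleftrightarrow> (\<forall>a\<in>A. \<forall>b\<in>B. (\<integral>y. a y * b y \<partial>M) = 0)"

definition independent_sets :: "'y measure \<Rightarrow> ('y \<Rightarrow> real) set \<Rightarrow> ('y \<Rightarrow> real) set \<Rightarrow> bool" where
  "independent_sets M A B \<longleftrightarrow> (\<forall>a\<in>A. \<forall>b\<in>B. prob_space.indep_var M borel a borel b)"

text \<open>
  Scalar multiples of arbitrary sign are essential for the variation of an orthogonal direct sum:
  for \<open>A = {a}\<close> and \<open>B = {b}\<close> the variation of \<open>A + B\<close> is not the sum of the variations. Every
  linear subspace is homogeneous.
\<close>

definition homogeneous :: "('y \<Rightarrow> real) set \<Rightarrow> bool" where
  "homogeneous A \<longleftrightarrow> A \<noteq> {} \<and> (\<forall>c. \<forall>a\<in>A. fscale c a \<in> A)"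

definition elementary_tensors ::
    "('y \<Rightarrow> real) set \<Rightarrow> ('y \<Rightarrow> real) set \<Rightarrow> ('y \<times> 'y \<Rightarrow> real) set" where
  "elementary_tensors A B = {\<lambda>z. a (fst z) * b (snd z) | a b. a \<in> A \<and> b \<in> B}"

definition tensor_product ::
    "('y \<Rightarrow> real) set \<Rightarrow> ('y \<Rightarrow> real) set \<Rightarrow> ('y \<times> 'y \<Rightarrow> real) set" where
  "tensor_product A B = fun_space.span (elementary_tensors A B)"


lemma subspace_imp_homogeneous: "fun_space.subspace A \<Longrightarrow> homogeneous A"
  by (auto simp: homogeneous_def fun_space.subspace_def)

lemma wspace_measurable_eq:
  assumes w: "w \<in> borel_measurable M"
    and int: "(\<integral>\<^sup>+y. inverse (ennreal (w y)) \<partial>M) < \<infinity>"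
  shows "wspace_measurable M w = wspace M w"
proof -
  have "integrable M (\<lambda>y. (v y)\<^sup>2)"
    if v[measurable]: "v \<in> borel_measurable M" and fin: "wnorm M w v < \<infinity>" for v
  proof -
    note w[measurable]
    have pos: "AE y in M. inverse (ennreal (w y)) \<noteq> \<infinity>"
      by (rule nn_integral_noteq_infinite) (use int in \<open>auto simp: less_top\<close>)
    obtain C where C: "wnorm M w v = ennreal C" "0 \<le> C"
      using fin by (cases "wnorm M w v") auto
    have "AE y in M. ennreal (sqrt (w y) * \<bar>v y\<bar>) \<le> ennreal C"
      using esssup_AE[of "\<lambda>y. ennreal (sqrt (w y) * \<bar>v y\<bar>)" M] unfolding C(1)[symmetric] wnorm_def .
    with pos have "AE y in M. ennreal ((v y)\<^sup>2) \<le> ennreal (C\<^sup>2) * inverse (ennreal (w y))"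
    proof eventually_elim
      case (elim y)
      have wy: "0 < w y"
      proof (rule ccontr)
        assume "\<not> 0 < w y"
        hence "ennreal (w y) = 0" by (simp add: ennreal_neg)
        thus False using elim(1) by simp
      qed
      have "sqrt (w y) * \<bar>v y\<bar> \<le> C" using elim(2) C(2) by simp
      hence "(sqrt (w y) * \<bar>v y\<bar>)\<^sup>2 \<le> C\<^sup>2" using wy by (intro power_mono) auto
      hence "w y * (v y)\<^sup>2 \<le> C\<^sup>2" using wy by (simp add: power_mult_distrib)
      hence "(v y)\<^sup>2 \<le> C\<^sup>2 * inverse (w y)" using wy by (simp add: field_simps)
      hence "ennreal ((v y)\<^sup>2) \<le> ennreal (C\<^sup>2 * inverse (w y))" by (rule ennreal_leI)
      thus ?case using wy by (simp add: ennreal_mult inverse_ennreal)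
    qed
    hence "(\<integral>\<^sup>+y. ennreal ((v y)\<^sup>2) \<partial>M) \<le> (\<integral>\<^sup>+y. ennreal (C\<^sup>2) * inverse (ennreal (w y)) \<partial>M)"
      by (rule nn_integral_mono_AE)
    also have "\<dots> = ennreal (C\<^sup>2) * (\<integral>\<^sup>+y. inverse (ennreal (w y)) \<partial>M)"
      by (rule nn_integral_cmult) simp
    also have "\<dots> < \<infinity>" using int by (simp add: ennreal_mult_less_top)
    finally show ?thesis by (intro integrableI_bounded) auto
  qed
  thus ?thesis by (auto simp: wspace_measurable_def wspace_def L2_space_def)
qed

lemma is_ess_Sup_unique:
  "is_ess_Sup M F s \<Longrightarrow> is_ess_Sup M F t \<Longrightarrow> AE y in M. s y = t y"
proof -
  assume "is_ess_Sup M F s" "is_ess_Sup M F t"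
  hence "AE y in M. s y \<le> t y" "AE y in M. t y \<le> s y" by (auto simp: is_ess_Sup_def)
  thus ?thesis by eventually_elim (rule antisym)
qed

lemma ennreal_inverse_antimono: "x \<le> y \<Longrightarrow> inverse y \<le> inverse x" for x y :: ennreal
proof (cases "x = 0 \<or> y = top")
  case False
  assume "x \<le> y"
  with False show ?thesis
    by (cases x; cases y) (auto simp: inverse_ennreal ennreal_le_iff less_le top_unique intro!: ennreal_leI le_imp_inverse_le)
qed auto

lemma ennreal_inverse_inverse: "inverse (inverse x) = x" for x :: ennreal
proof (cases x)
  case (real r)
  thus ?thesis by (cases "r = 0") (auto simp: inverse_ennreal)
qed auto

text \<open>The essential supremum exists and is attained by a countable subfamily.\<close>

lemma (in finite_measure) ex_countable_ess_Sup:
  fixes F :: "('a \<Rightarrow> ennreal) set"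
  assumes meas: "F \<subseteq> borel_measurable M"
  shows "\<exists>C\<subseteq>F. countable C \<and> is_ess_Sup M F (\<lambda>y. SUP f\<in>C. f y)"
proof -
  define S where "S = (\<lambda>(C :: ('a \<Rightarrow> ennreal) set) y. SUP f\<in>C. f y)"
  define I where "I = (\<lambda>C. \<integral>\<^sup>+y. inverse (1 + S C y) \<partial>M)"
  define \<C> where "\<C> = {C. C \<subseteq> F \<and> countable C}"
  have S_meas[measurable]: "S C \<in> borel_measurable M" if "C \<in> \<C>" for C
    using that meas unfolding S_def \<C>_def by (intro borel_measurable_SUP) auto
  have I_mono: "I D \<le> I C" if "C \<subseteq> D" for C D
    unfolding I_def S_def using that
    by (intro nn_integral_mono ennreal_inverse_antimono add_mono SUP_subset_mono) auto
  have I_fin: "I C \<noteq> \<infinity>" for C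
  proof -
    have "I C \<le> (\<integral>\<^sup>+y. 1 \<partial>M)" unfolding I_def
    proof (rule nn_integral_mono)
      fix y
      have "inverse (1 + S C y) \<le> inverse (1::ennreal)"
        by (rule ennreal_inverse_antimono) simp
      thus "inverse (1 + S C y) \<le> 1" by simp
    qed
    also have "\<dots> < \<infinity>" by (simp add: less_top[symmetric])
    finally show ?thesis by simp
  qed
  have ne: "I ` \<C> \<noteq> {}" by (auto simp: \<C>_def)
  obtain g :: "nat \<Rightarrow> ennreal" where g: "range g \<subseteq> I ` \<C>" "Inf (I ` \<C>) = (INF i. g i)"
    using ennreal_Inf_countable_INF[OF ne] by auto
  have "\<forall>i. \<exists>C. C \<in> \<C> \<and> g i = I C" using g(1) by blast
  then obtain c where c: "\<And>i. c i \<in> \<C>" "\<And>i. g i = I (c i)" by metis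
  define C where "C = (\<Union>i. c i)"
  have C: "C \<in> \<C>" using c(1) by (auto simp: C_def \<C>_def)
  have IC: "I C \<le> I D" if "D \<in> \<C>" for D
  proof -
    have "I C \<le> g i" for i unfolding c(2) by (rule I_mono) (auto simp: C_def)
    hence "I C \<le> (INF i. g i)" by (intro INF_greatest)
    also have "\<dots> \<le> I D" using that unfolding g(2)[symmetric] by (intro INF_lower)
    finally show ?thesis .
  qed
  have upper: "AE y in M. f y \<le> S C y" if f: "f \<in> F" for f
  proof -
    have D: "insert f C \<in> \<C>" using C f by (auto simp: \<C>_def)
    have le: "S C y \<le> S (insert f C) y" for y unfolding S_def by (rule SUP_subset_mono) auto
    have inv_le: "inverse (1 + S (insert f C) y) \<le> inverse (1 + S C y)" for y
      by (intro ennreal_inverse_antimono add_mono le order_refl)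
    have "(\<integral>\<^sup>+y. inverse (1 + S C y) - inverse (1 + S (insert f C) y) \<partial>M) = I C - I (insert f C)"
      unfolding I_def using C D I_fin[of "insert f C"] inv_le
      by (intro nn_integral_diff) (auto simp: I_def)
    also have "\<dots> = 0" using IC[OF D] I_fin[of C] by (simp add: diff_eq_0_iff_ennreal less_top)
    finally have "AE y in M. inverse (1 + S C y) - inverse (1 + S (insert f C) y) = 0"
      using C D by (subst (asm) nn_integral_0_iff_AE) auto
    thus ?thesis
    proof eventually_elim
      case (elim y)
      have "inverse (1 + S C y) \<le> inverse (1 + S (insert f C) y)"
        using elim by (simp add: diff_eq_0_iff_ennreal)
      hence "1 + S (insert f C) y \<le> 1 + S C y"
        by (metis ennreal_inverse_antimono ennreal_inverse_inverse)
      hence "S (insert f C) y \<le> S C y" by simp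
      moreover have "f y \<le> S (insert f C) y" unfolding S_def by (rule SUP_upper) simp
      ultimately show ?case by (rule order_trans[rotated])
    qed
  qed
  have least: "AE y in M. S C y \<le> t y" if t: "\<forall>f\<in>F. AE y in M. f y \<le> t y" for t
  proof -
    have "AE y in M. \<forall>f\<in>C. f y \<le> t y"
      using C t by (subst AE_ball_countable) (auto simp: \<C>_def)
    thus ?thesis by eventually_elim (auto simp: S_def intro: SUP_least)
  qed
  have "is_ess_Sup M F (S C)"
    using S_meas[OF C] upper least by (auto simp: is_ess_Sup_def)
  with C show ?thesis unfolding \<C>_def S_def by blast
qed

lemma (in finite_measure) is_ess_Sup_ess_Sup:
  "F \<subseteq> borel_measurable M \<Longrightarrow> is_ess_Sup M F (ess_Sup M F)"
  using ex_countable_ess_Sup[of F] unfolding ess_Sup_def by (metis someI)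

end

theory Submission
  imports Defs
begin

text \<open>
  The essential supremum in the definition of the variation function \<open>K\<close> of \<open>A\<close> is best read as a
  statement about point evaluation: \<open>K\<close> is the least measurable function with
  \<open>\<bar>u\<bar>\<^sup>2 \<le> \<parallel>u\<parallel>\<^sup>2 K\<close> almost everywhere for every \<open>u \<in> A\<close> (\<open>variation_le_iff\<close>). Upper bounds for a
  variation function are therefore proved for one element at a time. This settles unions, closures
  (both sides of the inequality pass to limits), and the bound for orthogonal sums (Pythagoras for
  the norms, Cauchy-Schwarz for the values).

  Lower bounds have to combine exceptional null sets. For orthogonal homogeneous sets the
  combination \<open>s a + t b\<close> that attains \<open>K\<^sub>A + K\<^sub>B\<close> at a point varies with the point, so the
  inequality is collected over rational \<open>(s, t)\<close> and extended by continuity. For products, both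
  suprema are attained by countable subfamilies, which turns them into pointwise suprema, and these
  multiply; the only other input is that norms multiply, which independence provides. Elementary
  tensors are products of functions of the two independent coordinates. A general element of the
  tensor product of two subspaces is expanded as \<open>\<Sum> \<alpha>\<^sub>e \<otimes> e\<close> with orthonormal \<open>e\<close>; the evaluation
  bound is then applied in one variable at a time (\<open>square_le_variation_tensor\<close>).

  The continuity statements share one estimate. As \<open>\<surd>K\<close> is a supremum of absolute values of unit
  elements, \<open>\<surd>(w K)\<close> moves by at most \<open>\<delta>\<close> if the sets of unit elements are within Hausdorff distance
  \<open>\<delta>\<close>. Where \<open>w K\<close> is bounded by \<open>R\<^sup>2\<close>, this makes \<open>w K\<close> itself move by at most
  \<open>2 \<delta> (R + \<delta>) + \<delta>\<^sup>2\<close> (\<open>wdist_real_variation_le\<close>), so finiteness of the variation is an open condition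
  and the variation depends continuously on the set of unit elements. What remains is to control
  that set: for cones it is the section with the unit sphere, and away from the origin
  normalisation is Lipschitz (\<open>wdist_normalized_le\<close>). Compact sets of nonzero functions stay away
  from the origin and are bounded, hence have finite variation.
\<close>

section \<open>The norm of \<open>L\<^sup>2\<close>\<close>

lemma L2_spaceD: "v \<in> L2_space M \<Longrightarrow> v \<in> borel_measurable M" "v \<in> L2_space M \<Longrightarrow> integrable M (\<lambda>y. (v y)\<^sup>2)"
  by (auto simp: L2_space_def)

lemma L2_space_scale:
  assumes "v \<in> L2_space M" shows "(\<lambda>y. c * v y) \<in> L2_space M"
  using assms by (auto simp: L2_space_def power_mult_distrib)

lemma L2_space_mult_integrable:
  assumes "u \<in> L2_space M" "v \<in> L2_space M"
  shows "integrable M (\<lambda>y. u y * v y)"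
proof (rule Bochner_Integration.integrable_bound)
  show "integrable M (\<lambda>y. (u y)\<^sup>2 + (v y)\<^sup>2)" using assms by (auto simp: L2_space_def)
  show "(\<lambda>y. u y * v y) \<in> borel_measurable M" using assms by (auto simp: L2_space_def)
  have "\<bar>a * b\<bar> \<le> a\<^sup>2 + b\<^sup>2" for a b :: real
  proof -
    have "2 * (\<bar>a\<bar> * \<bar>b\<bar>) \<le> a\<^sup>2 + b\<^sup>2"
      using zero_le_power2[of "\<bar>a\<bar> - \<bar>b\<bar>"] by (simp add: power2_diff)
    thus ?thesis unfolding abs_mult using mult_nonneg_nonneg[of "\<bar>a\<bar>" "\<bar>b\<bar>"] by linarith
  qed
  thus "AE y in M. norm (u y * v y) \<le> norm ((u y)\<^sup>2 + (v y)\<^sup>2)" by auto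
qed

lemma L2_space_add:
  assumes "u \<in> L2_space M" "v \<in> L2_space M"
  shows "(\<lambda>y. u y + v y) \<in> L2_space M"
  using assms L2_space_mult_integrable[OF assms] by (auto simp: L2_space_def power2_sum mult.assoc)

lemma L2_space_diff:
  assumes "u \<in> L2_space M" "v \<in> L2_space M"
  shows "(\<lambda>y. u y - v y) \<in> L2_space M"
  using L2_space_add[OF assms(1) L2_space_scale[OF assms(2), of "-1"]] by simp

lemma L2_norm_nonneg: "0 \<le> L2_norm M v"
  by (simp add: L2_norm_def)

lemma L2_norm_power2: "(L2_norm M v)\<^sup>2 = (\<integral>y. (v y)\<^sup>2 \<partial>M)"
  by (simp add: L2_norm_def)

lemma L2_norm_eq_0_iff:
  assumes "v \<in> L2_space M" shows "L2_norm M v = 0 \<longleftrightarrow> (AE y in M. v y = 0)"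
proof -
  have "L2_norm M v = 0 \<longleftrightarrow> (\<integral>y. (v y)\<^sup>2 \<partial>M) = 0" by (simp add: L2_norm_def)
  also have "\<dots> \<longleftrightarrow> (AE y in M. (v y)\<^sup>2 = 0)"
    using assms by (intro integral_nonneg_eq_0_iff_AE) (auto simp: L2_space_def)
  finally show ?thesis by simp
qed

lemma L2_norm_pos_iff:
  "v \<in> L2_space M \<Longrightarrow> 0 < L2_norm M v \<longleftrightarrow> \<not> (AE y in M. v y = 0)"
  using L2_norm_eq_0_iff[of v M] L2_norm_nonneg[of M v] by linarith

lemma L2_norm_scale: "L2_norm M (\<lambda>y. c * v y) = \<bar>c\<bar> * L2_norm M v"
  by (simp add: L2_norm_def power_mult_distrib real_sqrt_mult)

lemma L2_norm_cong_AE: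
  assumes "u \<in> borel_measurable M" "v \<in> borel_measurable M" "AE y in M. u y = v y"
  shows "L2_norm M u = L2_norm M v"
  unfolding L2_norm_def using assms by (intro arg_cong[of _ _ sqrt] integral_cong_AE) auto

text \<open>
  Minkowski's inequality comes from integrating the pointwise bound
  \<open>(u + v)\<^sup>2 \<le> (a + b) (u\<^sup>2 / a + v\<^sup>2 / b)\<close>, where \<open>a\<close> and \<open>b\<close> are positive upper bounds of the
  two norms; the slack \<open>e\<close> keeps them positive when a norm vanishes.
\<close>

lemma L2_norm_triangle:
  assumes "u \<in> L2_space M" "v \<in> L2_space M"
  shows "L2_norm M (\<lambda>y. u y + v y) \<le> L2_norm M u + L2_norm M v"
proof (rule field_le_epsilon)
  fix e :: real assume "0 < e"
  define a where "a = L2_norm M u + e / 2"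
  define b where "b = L2_norm M v + e / 2"
  have ab: "0 < a" "0 < b" "L2_norm M u \<le> a" "L2_norm M v \<le> b"
    using \<open>0 < e\<close> L2_norm_nonneg[of M] by (auto simp: a_def b_def add_nonneg_pos)
  have pw: "(x + z)\<^sup>2 \<le> (a + b) * (x\<^sup>2 / a + z\<^sup>2 / b)" for x z :: real
  proof -
    have "(a + b) * (x\<^sup>2 / a + z\<^sup>2 / b) - (x + z)\<^sup>2 = (b * x - a * z)\<^sup>2 / (a * b)"
      using ab by (simp add: field_simps power2_eq_square)
    also have "\<dots> \<ge> 0" using ab by simp
    finally show ?thesis by simp
  qed
  have int: "integrable M (\<lambda>y. (u y)\<^sup>2)" "integrable M (\<lambda>y. (v y)\<^sup>2)"
    using assms by (auto simp: L2_space_def)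
  have "(L2_norm M (\<lambda>y. u y + v y))\<^sup>2 \<le> (\<integral>y. (a + b) * ((u y)\<^sup>2 / a + (v y)\<^sup>2 / b) \<partial>M)"
    unfolding L2_norm_power2 using pw int L2_spaceD(2)[OF L2_space_add[OF assms]]
    by (intro integral_mono) auto
  also have "\<dots> = (a + b) * ((L2_norm M u)\<^sup>2 / a + (L2_norm M v)\<^sup>2 / b)"
    using int by (simp add: L2_norm_power2)
  also have "\<dots> \<le> (a + b) * (a\<^sup>2 / a + b\<^sup>2 / b)"
    using ab L2_norm_nonneg[of M]
    by (intro mult_left_mono add_mono divide_right_mono power_mono) auto
  also have "\<dots> = (a + b)\<^sup>2" using ab by (simp add: power2_eq_square)
  finally have "L2_norm M (\<lambda>y. u y + v y) \<le> a + b"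
    using ab by (simp add: power2_le_iff_abs_le)
  thus "L2_norm M (\<lambda>y. u y + v y) \<le> L2_norm M u + L2_norm M v + e"
    by (simp add: a_def b_def)
qed

lemma L2_norm_minus_commute: "L2_norm M (\<lambda>y. u y - v y) = L2_norm M (\<lambda>y. v y - u y)"
  by (simp add: L2_norm_def power2_commute)

lemma L2_norm_diff_abs:
  assumes "u \<in> L2_space M" "v \<in> L2_space M"
  shows "\<bar>L2_norm M u - L2_norm M v\<bar> \<le> L2_norm M (\<lambda>y. u y - v y)"
  using L2_norm_triangle[OF L2_space_diff[OF assms] assms(2)]
    L2_norm_triangle[OF L2_space_diff[OF assms(2,1)] assms(1)]
    L2_norm_minus_commute[of M u v] by simp

section \<open>The variation function as a bound for point evaluation\<close>

lemma normalized_image: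
  "normalized M A = (\<lambda>u y. u y / L2_norm M u) ` {u \<in> A. \<not> (AE y in M. u y = 0)}"
  by (auto simp: normalized_def)

lemma normalized_L2:
  assumes "A \<subseteq> L2_space M" "a \<in> normalized M A"
  shows "a \<in> L2_space M" "L2_norm M a = 1"
proof -
  obtain u where u: "a = (\<lambda>y. (1 / L2_norm M u) * u y)" "u \<in> A" "\<not> (AE y in M. u y = 0)"
    using assms(2) by (auto simp: normalized_def)
  hence "u \<in> L2_space M" "0 < L2_norm M u" using assms(1) L2_norm_pos_iff[of u M] by auto
  thus "a \<in> L2_space M" "L2_norm M a = 1"
    unfolding u(1) L2_norm_scale by (simp_all only: L2_space_scale) simp
qed

lemma squares_borel:
  "A \<subseteq> borel_measurable M \<Longrightarrow> (\<lambda>a y. ennreal (\<bar>a y\<bar>\<^sup>2)) ` A \<subseteq> borel_measurable M"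
  by (auto simp: subset_eq)

lemma ennreal_divide_square_le_iff:
  fixes x c :: real and s :: ennreal
  assumes "0 < c"
  shows "ennreal ((x / c)\<^sup>2) \<le> s \<longleftrightarrow> ennreal (x\<^sup>2) \<le> ennreal (c\<^sup>2) * s"
proof (cases s)
  case (real r)
  with assms show ?thesis
    by (simp add: ennreal_mult[symmetric] power_divide divide_le_eq mult.commute)
qed (use assms in \<open>simp add: ennreal_mult_top\<close>)

context prob_space
begin

lemma variation_is_ess_Sup:
  assumes "A \<subseteq> L2_space M"
  shows "is_ess_Sup M ((\<lambda>a y. ennreal (\<bar>a y\<bar>\<^sup>2)) ` normalized M A) (variation M A)"
  unfolding variation_def
  using normalized_L2[OF assms] by (intro is_ess_Sup_ess_Sup squares_borel) (auto simp: L2_space_def)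

lemma variation_measurable:
  "A \<subseteq> L2_space M \<Longrightarrow> variation M A \<in> borel_measurable M"
  using variation_is_ess_Sup by (simp add: is_ess_Sup_def)

text \<open>
  Clearing the normalising denominators turns the definition into the statement that the
  variation is the least \<open>t\<close> for which point evaluation is bounded by \<open>\<bar>u\<bar>\<^sup>2 \<le> \<parallel>u\<parallel>\<^sup>2 t\<close> on \<open>A\<close>.
  The bound is trivial for \<open>u = 0\<close>, so null functions no longer have to be excluded.
\<close>

lemma variation_le_iff:
  assumes A: "A \<subseteq> L2_space M" and t: "t \<in> borel_measurable M"
  shows "(AE y in M. variation M A y \<le> t y) \<longleftrightarrow>
    (\<forall>u\<in>A. AE y in M. ennreal ((u y)\<^sup>2) \<le> ennreal ((L2_norm M u)\<^sup>2) * t y)"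
proof -
  have "(AE y in M. variation M A y \<le> t y) \<longleftrightarrow>
      (\<forall>a\<in>normalized M A. AE y in M. ennreal (\<bar>a y\<bar>\<^sup>2) \<le> t y)"
  proof
    assume l: "AE y in M. variation M A y \<le> t y"
    show "\<forall>a\<in>normalized M A. AE y in M. ennreal (\<bar>a y\<bar>\<^sup>2) \<le> t y"
    proof
      fix a assume "a \<in> normalized M A"
      hence "AE y in M. ennreal (\<bar>a y\<bar>\<^sup>2) \<le> variation M A y"
        using variation_is_ess_Sup[OF A] by (auto simp: is_ess_Sup_def)
      with l show "AE y in M. ennreal (\<bar>a y\<bar>\<^sup>2) \<le> t y" by eventually_elim (rule order_trans)
    qed
  qed (use variation_is_ess_Sup[OF A] t in \<open>auto simp: is_ess_Sup_def\<close>)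
  also have "\<dots> \<longleftrightarrow> (\<forall>u\<in>A. \<not> (AE y in M. u y = 0) \<longrightarrow>
      (AE y in M. ennreal ((u y / L2_norm M u)\<^sup>2) \<le> t y))"
    unfolding normalized_image ball_simps by auto
  also have "\<dots> \<longleftrightarrow> (\<forall>u\<in>A. AE y in M. ennreal ((u y)\<^sup>2) \<le> ennreal ((L2_norm M u)\<^sup>2) * t y)"
  proof (rule ball_cong[OF refl])
    fix u assume "u \<in> A"
    hence u: "u \<in> L2_space M" using A by auto
    show "(\<not> (AE y in M. u y = 0) \<longrightarrow> (AE y in M. ennreal ((u y / L2_norm M u)\<^sup>2) \<le> t y)) \<longleftrightarrow>
        (AE y in M. ennreal ((u y)\<^sup>2) \<le> ennreal ((L2_norm M u)\<^sup>2) * t y)"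
    proof (cases "AE y in M. u y = 0")
      case True
      hence "AE y in M. ennreal ((u y)\<^sup>2) \<le> ennreal ((L2_norm M u)\<^sup>2) * t y"
        by eventually_elim simp
      with True show ?thesis by simp
    next
      case False
      hence pos: "0 < L2_norm M u" using L2_norm_pos_iff[OF u] by simp
      with False show ?thesis by (simp only: ennreal_divide_square_le_iff)  simp
    qed
  qed
  finally show ?thesis .
qed

lemma square_le_variation:
  assumes "A \<subseteq> L2_space M" "u \<in> A"
  shows "AE y in M. ennreal ((u y)\<^sup>2) \<le> ennreal ((L2_norm M u)\<^sup>2) * variation M A y"
  using variation_le_iff[OF assms(1) variation_measurable[OF assms(1)]] assms(2) by simp

lemma variation_mono:
  assumes "A \<subseteq> B" "B \<subseteq> L2_space M"
  shows "AE y in M. variation M A y \<le> variation M B y"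
  using assms square_le_variation[OF assms(2)] variation_measurable[OF assms(2)]
  by (subst variation_le_iff) auto

end

section \<open>Unions and orthogonal sums\<close>

lemma rational_sequence:
  obtains r :: "nat \<Rightarrow> real" where "\<And>n. r n \<in> \<rat>" "r \<longlonglongrightarrow> x"
proof -
  have "x \<in> closure \<rat>" by (simp add: Rats_closure_real)
  thus ?thesis using that unfolding closure_sequential by blast
qed

text \<open>
  The quotient \<open>(s a + t b)\<^sup>2 / (s\<^sup>2 \<alpha> + t\<^sup>2 \<beta>)\<close> is maximal, with value \<open>a\<^sup>2 / \<alpha> + b\<^sup>2 / \<beta>\<close>, at
  \<open>(s, t) = (\<beta> a, \<alpha> b)\<close>, and rational pairs approximate this one.
\<close>

lemma weighted_squares_le_of_rational_combinations:
  fixes a b \<alpha> \<beta> k :: real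
  assumes pos: "0 < \<alpha>" "0 < \<beta>" and k: "0 \<le> k"
    and rat: "\<And>s t. s \<in> \<rat> \<Longrightarrow> t \<in> \<rat> \<Longrightarrow> (s * a + t * b)\<^sup>2 \<le> (s\<^sup>2 * \<alpha> + t\<^sup>2 * \<beta>) * k"
  shows "a\<^sup>2 * \<beta> + b\<^sup>2 * \<alpha> \<le> \<alpha> * \<beta> * k"
proof -
  define q where "q = a\<^sup>2 * \<beta> + b\<^sup>2 * \<alpha>"
  obtain r where r: "\<And>n. r n \<in> \<rat>" "r \<longlonglongrightarrow> \<beta> * a" using rational_sequence by blast
  obtain r' where r': "\<And>n. r' n \<in> \<rat>" "r' \<longlonglongrightarrow> \<alpha> * b" using rational_sequence by blast
  have "(\<beta> * a * a + \<alpha> * b * b)\<^sup>2 \<le> ((\<beta> * a)\<^sup>2 * \<alpha> + (\<alpha> * b)\<^sup>2 * \<beta>) * k"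
  proof (rule LIMSEQ_le)
    show "(\<lambda>n. (r n * a + r' n * b)\<^sup>2) \<longlonglongrightarrow> (\<beta> * a * a + \<alpha> * b * b)\<^sup>2"
      by (intro tendsto_intros r r')
    show "(\<lambda>n. ((r n)\<^sup>2 * \<alpha> + (r' n)\<^sup>2 * \<beta>) * k) \<longlonglongrightarrow> ((\<beta> * a)\<^sup>2 * \<alpha> + (\<alpha> * b)\<^sup>2 * \<beta>) * k"
      by (intro tendsto_intros r r')
  qed (use rat r(1) r'(1) in auto)
  hence "q * q \<le> (\<alpha> * \<beta> * k) * q"
    by (simp add: q_def power2_eq_square algebra_simps)
  moreover have "0 \<le> q" "0 \<le> \<alpha> * \<beta> * k" using pos k by (auto simp: q_def)
  ultimately show ?thesis unfolding q_def[symmetric]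
    by (cases "q = 0") (auto simp: mult_le_cancel_right)
qed

text \<open>
  The Cauchy-Schwarz inequality \<open>(c \<surd>p + d \<surd>q)\<^sup>2 \<le> (c\<^sup>2 + d\<^sup>2) (p + q)\<close>, in the form in which it
  adds two evaluation bounds.
\<close>

lemma ennreal_square_sum_le:
  fixes x z c d :: real and p q :: ennreal
  assumes "ennreal (x\<^sup>2) \<le> ennreal (c\<^sup>2) * p" "ennreal (z\<^sup>2) \<le> ennreal (d\<^sup>2) * q"
  shows "ennreal ((x + z)\<^sup>2) \<le> ennreal (c\<^sup>2 + d\<^sup>2) * (p + q)"
proof (cases "p = \<top> \<or> q = \<top>")
  case True
  show ?thesis
  proof (cases "c = 0 \<and> d = 0")
    case True
    with assms show ?thesis by simp
  next
    case False
    hence "0 < c\<^sup>2 + d\<^sup>2" by (simp add: sum_power2_gt_zero_iff)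
    with True show ?thesis by (auto simp: ennreal_mult_top)
  qed
next
  case False
  then obtain k l where kl: "p = ennreal k" "q = ennreal l" "0 \<le> k" "0 \<le> l"
    by (cases p; cases q) auto
  have xz: "x\<^sup>2 \<le> c\<^sup>2 * k" "z\<^sup>2 \<le> d\<^sup>2 * l"
    using assms kl by (simp_all add: ennreal_mult[symmetric])
  have "(x * z)\<^sup>2 \<le> (c\<^sup>2 * k) * (d\<^sup>2 * l)"
    unfolding power_mult_distrib using xz kl by (intro mult_mono) auto
  also have "\<dots> = (c\<^sup>2 * l) * (d\<^sup>2 * k)" by simp
  finally have "(2 * (x * z))\<^sup>2 \<le> 4 * ((c\<^sup>2 * l) * (d\<^sup>2 * k))" by (simp add: power_mult_distrib)
  also have "\<dots> \<le> (c\<^sup>2 * l + d\<^sup>2 * k)\<^sup>2"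
    using zero_le_power2[of "c\<^sup>2 * l - d\<^sup>2 * k"] by (simp add: power2_diff power2_sum algebra_simps)
  finally have "2 * (x * z) \<le> c\<^sup>2 * l + d\<^sup>2 * k"
    using kl by (meson add_nonneg_nonneg mult_nonneg_nonneg power2_le_imp_le zero_le_power2)
  hence "(x + z)\<^sup>2 \<le> (c\<^sup>2 + d\<^sup>2) * (k + l)"
    using xz by (simp add: power2_sum algebra_simps)
  thus ?thesis using kl by (simp add: ennreal_mult[symmetric] flip: ennreal_plus)
qed

lemma L2_norm_add_orthogonal:
  assumes "u \<in> L2_space M" "v \<in> L2_space M" "(\<integral>y. u y * v y \<partial>M) = 0"
  shows "(L2_norm M (\<lambda>y. u y + v y))\<^sup>2 = (L2_norm M u)\<^sup>2 + (L2_norm M v)\<^sup>2"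
  unfolding L2_norm_power2 using assms L2_space_mult_integrable[OF assms(1,2)]
  by (simp add: power2_sum L2_space_def mult.assoc)

lemma set_plus_L2:
  "A \<subseteq> L2_space M \<Longrightarrow> B \<subseteq> L2_space M \<Longrightarrow> A + B \<subseteq> L2_space M"
  by (auto simp: set_plus_def plus_fun_def intro!: L2_space_add)

context prob_space
begin

lemma variation_Union:
  assumes "\<A> \<subseteq> Pow (L2_space M)"
  shows "AE y in M. variation M (\<Union>\<A>) y = ess_Sup M (variation M ` \<A>) y"
proof -
  define s where "s = ess_Sup M (variation M ` \<A>)"
  have U: "\<Union>\<A> \<subseteq> L2_space M" using assms by auto
  have "is_ess_Sup M (variation M ` \<A>) s"
    unfolding s_def using assms by (intro is_ess_Sup_ess_Sup) (auto intro!: variation_measurable)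
  hence s: "s \<in> borel_measurable M" "\<And>A. A \<in> \<A> \<Longrightarrow> AE y in M. variation M A y \<le> s y"
    "\<And>t. t \<in> borel_measurable M \<Longrightarrow> (\<And>A. A \<in> \<A> \<Longrightarrow> AE y in M. variation M A y \<le> t y) \<Longrightarrow>
        AE y in M. s y \<le> t y"
    by (auto simp: is_ess_Sup_def)
  have "AE y in M. variation M (\<Union>\<A>) y \<le> s y"
  proof (subst variation_le_iff[OF U s(1)], intro ballI)
    fix u assume "u \<in> \<Union>\<A>"
    then obtain A where "A \<in> \<A>" "u \<in> A" by blast
    thus "AE y in M. ennreal ((u y)\<^sup>2) \<le> ennreal ((L2_norm M u)\<^sup>2) * s y"
      using variation_le_iff[of A s] s(1,2) assms by auto
  qed
  moreover have "AE y in M. s y \<le> variation M (\<Union>\<A>) y"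
    using U by (intro s(3) variation_measurable variation_mono) auto
  ultimately show ?thesis unfolding s_def by eventually_elim (rule antisym)
qed

lemma variation_add_le:
  assumes A: "A \<subseteq> L2_space M" and B: "B \<subseteq> L2_space M" and orth: "orthogonal_sets M A B"
  shows "AE y in M. variation M (A + B) y \<le> variation M A y + variation M B y"
proof (subst variation_le_iff[OF set_plus_L2[OF A B]])
  show "(\<lambda>y. variation M A y + variation M B y) \<in> borel_measurable M"
    using variation_measurable[OF A] variation_measurable[OF B] by measurable
  show "\<forall>u\<in>A + B. AE y in M. ennreal ((u y)\<^sup>2) \<le>
      ennreal ((L2_norm M u)\<^sup>2) * (variation M A y + variation M B y)"
  proof
    fix u assume "u \<in> A + B"
    then obtain a b where ab: "a \<in> A" "b \<in> B" "u = (\<lambda>y. a y + b y)"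
      by (auto simp: set_plus_def plus_fun_def)
    have norm: "(L2_norm M u)\<^sup>2 = (L2_norm M a)\<^sup>2 + (L2_norm M b)\<^sup>2"
      unfolding ab(3) using ab A B orth
      by (intro L2_norm_add_orthogonal) (auto simp: orthogonal_sets_def)
    show "AE y in M. ennreal ((u y)\<^sup>2) \<le> ennreal ((L2_norm M u)\<^sup>2) * (variation M A y + variation M B y)"
      using square_le_variation[OF A ab(1)] square_le_variation[OF B ab(2)]
      unfolding norm by eventually_elim (simp only: ab(3) ennreal_square_sum_le)
  qed
qed

lemma homogeneous_scale: "homogeneous A \<Longrightarrow> a \<in> A \<Longrightarrow> (\<lambda>y. c * a y) \<in> A"
  unfolding homogeneous_def fscale_def by force

lemma homogeneous_zero: "homogeneous A \<Longrightarrow> (\<lambda>y. 0) \<in> A"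
  using homogeneous_scale[of A _ 0] by (auto simp: homogeneous_def)

lemma homogeneous_subset_add:
  assumes "homogeneous A" "homogeneous B"
  shows "A \<subseteq> A + B" "B \<subseteq> A + B"
proof -
  have "0 \<in> A" "0 \<in> B"
    using homogeneous_zero[OF assms(1)] homogeneous_zero[OF assms(2)] by (simp_all add: zero_fun_def)
  thus "A \<subseteq> A + B" "B \<subseteq> A + B"
    using set_zero_plus2[of B A] set_zero_plus2[of A B] by (simp_all add: add.commute)
qed

text \<open>
  Homogeneity makes every combination of \<open>a\<close> and \<open>b\<close> available. At a point \<open>y\<close>, the combination
  \<open>s a + t b\<close> with \<open>(s, t)\<close> proportional to \<open>(a y / \<parallel>a\<parallel>\<^sup>2, b y / \<parallel>b\<parallel>\<^sup>2)\<close> is the optimal one.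
  Since \<open>(s, t)\<close> depends on \<open>y\<close> while every bound holds only almost everywhere, the bound is first
  collected over the countably many rational pairs.
\<close>

lemma sum_normalized_squares_le_variation:
  assumes A: "A \<subseteq> L2_space M" and B: "B \<subseteq> L2_space M" and orth: "orthogonal_sets M A B"
    and hom: "homogeneous A" "homogeneous B" and a: "a \<in> A" and b: "b \<in> B"
    and pos: "0 < L2_norm M a" "0 < L2_norm M b"
  shows "AE y in M. ennreal ((a y / L2_norm M a)\<^sup>2) + ennreal ((b y / L2_norm M b)\<^sup>2)
    \<le> variation M (A + B) y"
proof -
  let ?K = "variation M (A + B)"
  let ?\<alpha> = "(L2_norm M a)\<^sup>2" and ?\<beta> = "(L2_norm M b)\<^sup>2"
  have "AE y in M. ennreal ((s * a y + t * b y)\<^sup>2) \<le> ennreal (s\<^sup>2 * ?\<alpha> + t\<^sup>2 * ?\<beta>) * ?K y" for s t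
  proof -
    have mem: "(\<lambda>y. s * a y) \<in> A" "(\<lambda>y. t * b y) \<in> B"
      using hom a b by (auto intro: homogeneous_scale)
    hence "(\<lambda>y. s * a y) + (\<lambda>y. t * b y) \<in> A + B" by (rule set_plus_intro)
    hence "(\<lambda>y. s * a y + t * b y) \<in> A + B" by (simp add: plus_fun_def)
    from square_le_variation[OF set_plus_L2[OF A B] this]
    show ?thesis using mem A B orth
      by (subst (asm) L2_norm_add_orthogonal)
        (auto simp: orthogonal_sets_def L2_norm_scale power_mult_distrib)
  qed
  hence "AE y in M. \<forall>s\<in>\<rat>. \<forall>t\<in>\<rat>.
      ennreal ((s * a y + t * b y)\<^sup>2) \<le> ennreal (s\<^sup>2 * ?\<alpha> + t\<^sup>2 * ?\<beta>) * ?K y"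
    by (simp add: AE_ball_countable countable_rat)
  thus ?thesis
  proof eventually_elim
    case (elim y)
    show ?case
    proof (cases "?K y")
      case (real k)
      have "(s * a y + t * b y)\<^sup>2 \<le> (s\<^sup>2 * ?\<alpha> + t\<^sup>2 * ?\<beta>) * k" if "s \<in> \<rat>" "t \<in> \<rat>" for s t
        using elim that real by (auto simp: ennreal_mult[symmetric] simp del: ennreal_plus)
      hence "(a y)\<^sup>2 * ?\<beta> + (b y)\<^sup>2 * ?\<alpha> \<le> ?\<alpha> * ?\<beta> * k"
        using real pos by (intro weighted_squares_le_of_rational_combinations) auto
      hence "(a y / L2_norm M a)\<^sup>2 + (b y / L2_norm M b)\<^sup>2 \<le> k"
        using pos by (simp add: power_divide field_simps)
      thus ?thesis using real by (simp flip: ennreal_plus)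
    qed simp
  qed
qed

text \<open>
  The bound for pairs passes to the two suprema one factor at a time: \<open>\<bar>a\<bar>\<^sup>2 \<le> K - \<bar>b\<bar>\<^sup>2\<close> for all
  unit \<open>a\<close> gives a bound on the variation of \<open>A\<close>, and the same step is repeated for \<open>b\<close>.
\<close>

lemma variation_add_ge:
  assumes A: "A \<subseteq> L2_space M" and B: "B \<subseteq> L2_space M" and orth: "orthogonal_sets M A B"
    and hom: "homogeneous A" "homogeneous B"
  shows "AE y in M. variation M A y + variation M B y \<le> variation M (A + B) y"
proof -
  let ?K = "variation M (A + B)"
  have AB: "A + B \<subseteq> L2_space M" by (rule set_plus_L2[OF A B])
  note [measurable] = variation_measurable[OF A] variation_measurable[OF AB]
  have mono: "AE y in M. variation M A y \<le> ?K y"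
    by (rule variation_mono[OF homogeneous_subset_add(1)[OF hom] AB])
  have "AE y in M. variation M B y \<le> ?K y - variation M A y"
  proof (subst variation_le_iff[OF B], measurable, intro ballI)
    fix b assume b: "b \<in> B"
    hence [measurable]: "b \<in> borel_measurable M" using B by (auto simp: L2_space_def)
    show "AE y in M. ennreal ((b y)\<^sup>2) \<le> ennreal ((L2_norm M b)\<^sup>2) * (?K y - variation M A y)"
    proof (cases "0 < L2_norm M b")
      case False
      hence "AE y in M. b y = 0" using B b L2_norm_pos_iff by blast
      thus ?thesis by eventually_elim simp
    next
      case pos: True
      have ub: "AE y in M. ennreal ((b y / L2_norm M b)\<^sup>2) \<le> ?K y"
        using square_le_variation[OF AB, of b] homogeneous_subset_add(2)[OF hom] b
        by (auto simp: ennreal_divide_square_le_iff[OF pos])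
      have "AE y in M. variation M A y \<le> ?K y - ennreal ((b y / L2_norm M b)\<^sup>2)"
      proof (subst variation_le_iff[OF A], measurable, intro ballI)
        fix a assume a: "a \<in> A"
        show "AE y in M. ennreal ((a y)\<^sup>2) \<le>
          ennreal ((L2_norm M a)\<^sup>2) * (?K y - ennreal ((b y / L2_norm M b)\<^sup>2))"
        proof (cases "0 < L2_norm M a")
          case False
          hence "AE y in M. a y = 0" using A a L2_norm_pos_iff by blast
          thus ?thesis by eventually_elim simp
        next
          case True
          show ?thesis
            using sum_normalized_squares_le_variation[OF A B orth hom a b True pos]
          proof eventually_elim
            case (elim y)
            thus ?case
              by (simp only: ennreal_divide_square_le_iff[OF True, symmetric] ennreal_le_minus_iff) simp
          qed
        qed
      qed
      with ub mono show ?thesis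
      proof eventually_elim
        case (elim y)
        have "variation M A y + ennreal ((b y / L2_norm M b)\<^sup>2) \<le> ?K y"
          using elim(1,3) by (metis add_mono_thms_linordered_semiring(3) diff_add_cancel_ennreal)
        thus ?case
          by (simp only: ennreal_divide_square_le_iff[OF pos, symmetric] ennreal_le_minus_iff)
            (simp add: add.commute)
      qed
    qed
  qed
  with mono show ?thesis
    by eventually_elim (metis add_left_mono add_diff_inverse_ennreal)
qed

end

section \<open>Products of independent sets\<close>

context prob_space
begin

lemma normalized_square_le_variation:
  assumes A: "A \<subseteq> L2_space M" and u: "u \<in> A"
  shows "AE y in M. ennreal ((u y / L2_norm M u)\<^sup>2) \<le> variation M A y"
proof (cases "0 < L2_norm M u")
  case True
  show ?thesis using square_le_variation[OF assms] by (simp only: ennreal_divide_square_le_iff[OF True])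
next
  case False
  hence "L2_norm M u = 0" using L2_norm_nonneg[of M u] by simp
  thus ?thesis by simp
qed

text \<open>
  A countable pointwise supremum can be handled at each point and composed with other maps, which
  an essential supremum cannot.
\<close>

lemma variation_eq_countable_SUP:
  assumes A: "A \<subseteq> L2_space M"
  obtains C where "C \<subseteq> A" "countable C"
    "AE y in M. variation M A y = (SUP u\<in>C. ennreal ((u y / L2_norm M u)\<^sup>2))"
proof -
  let ?F = "(\<lambda>a y. ennreal (\<bar>a y\<bar>\<^sup>2)) ` normalized M A"
  have "?F \<subseteq> borel_measurable M"
    using normalized_L2[OF A] by (intro squares_borel) (auto simp: L2_space_def)
  from ex_countable_ess_Sup[OF this] obtain D
    where D: "D \<subseteq> ?F" "countable D" "is_ess_Sup M ?F (\<lambda>y. SUP f\<in>D. f y)" by blast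
  have "?F = (\<lambda>u y. ennreal ((u y / L2_norm M u)\<^sup>2)) ` {u \<in> A. \<not> (AE y in M. u y = 0)}"
    unfolding normalized_image image_image power2_abs ..
  with D(1,2) have "\<exists>C. countable C \<and> C \<subseteq> {u \<in> A. \<not> (AE y in M. u y = 0)} \<and>
      D = (\<lambda>u y. ennreal ((u y / L2_norm M u)\<^sup>2)) ` C"
    by (intro countable_subset_image[THEN iffD1]) simp
  then obtain C where C: "C \<subseteq> A" "countable C" "D = (\<lambda>u y. ennreal ((u y / L2_norm M u)\<^sup>2)) ` C"
    by blast
  have "AE y in M. variation M A y = (SUP u\<in>C. ennreal ((u y / L2_norm M u)\<^sup>2))"
    using is_ess_Sup_unique[OF variation_is_ess_Sup[OF A] D(3)] by (simp add: C(3) image_image)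
  with C that show ?thesis by blast
qed

text \<open>
  When norms multiply, the unit elements of the product set are the products of unit elements, and
  suprema of nonnegative families multiply. Countable families attaining the two suprema allow the
  almost everywhere bounds to be combined before the suprema are taken.
\<close>

lemma variation_mult:
  assumes A: "A \<subseteq> L2_space M" and B: "B \<subseteq> L2_space M" and AB: "A * B \<subseteq> L2_space M"
    and norm: "\<And>a b. a \<in> A \<Longrightarrow> b \<in> B \<Longrightarrow> L2_norm M (\<lambda>y. a y * b y) = L2_norm M a * L2_norm M b"
  shows "AE y in M. variation M (A * B) y = variation M A y * variation M B y"
proof -
  have mem: "(\<lambda>y. a y * b y) \<in> A * B" if "a \<in> A" "b \<in> B" for a b
    using set_times_intro[OF that] by (simp add: times_fun_def)
  have "AE y in M. variation M (A * B) y \<le> variation M A y * variation M B y"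
  proof (subst variation_le_iff[OF AB])
    show "(\<lambda>y. variation M A y * variation M B y) \<in> borel_measurable M"
      using variation_measurable[OF A] variation_measurable[OF B] by measurable
    show "\<forall>u\<in>A * B. AE y in M. ennreal ((u y)\<^sup>2) \<le>
      ennreal ((L2_norm M u)\<^sup>2) * (variation M A y * variation M B y)"
    proof
      fix u assume "u \<in> A * B"
      then obtain a b where ab: "a \<in> A" "b \<in> B" "u = (\<lambda>y. a y * b y)"
        by (auto simp: set_times_def times_fun_def)
      show "AE y in M. ennreal ((u y)\<^sup>2) \<le>
          ennreal ((L2_norm M u)\<^sup>2) * (variation M A y * variation M B y)"
        using square_le_variation[OF A ab(1)] square_le_variation[OF B ab(2)]
      proof eventually_elim
        case (elim y)
        from mult_mono[OF this] show ?case
          unfolding ab(3) norm[OF ab(1,2)] by (simp add: power_mult_distrib ennreal_mult mult_ac)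
      qed
    qed
  qed
  moreover have "AE y in M. variation M A y * variation M B y \<le> variation M (A * B) y"
  proof -
    obtain C where C: "C \<subseteq> A" "countable C"
      "AE y in M. variation M A y = (SUP u\<in>C. ennreal ((u y / L2_norm M u)\<^sup>2))"
      by (rule variation_eq_countable_SUP[OF A])
    obtain D where D: "D \<subseteq> B" "countable D"
      "AE y in M. variation M B y = (SUP u\<in>D. ennreal ((u y / L2_norm M u)\<^sup>2))"
      by (rule variation_eq_countable_SUP[OF B])
    have "AE y in M. ennreal ((a y / L2_norm M a)\<^sup>2) * ennreal ((b y / L2_norm M b)\<^sup>2) \<le> variation M (A * B) y"
      if "a \<in> C" "b \<in> D" for a b
    proof -
      have ab: "a \<in> A" "b \<in> B" using that C D by auto
      from normalized_square_le_variation[OF AB mem[OF ab]] show ?thesis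
        by (simp add: norm[OF ab] ennreal_mult[symmetric] power_mult_distrib[symmetric])
    qed
    hence "AE y in M. \<forall>a\<in>C. \<forall>b\<in>D. ennreal ((a y / L2_norm M a)\<^sup>2) * ennreal ((b y / L2_norm M b)\<^sup>2)
        \<le> variation M (A * B) y"
      using C(2) D(2) by (simp add: AE_ball_countable)
    with C(3) D(3) show ?thesis
      by eventually_elim (auto simp: SUP_mult_left_ennreal SUP_mult_right_ennreal intro!: SUP_least)
  qed
  ultimately show ?thesis by eventually_elim (rule antisym)
qed

lemma indep_var_L2_mult:
  assumes "indep_var borel a borel b" "a \<in> L2_space M" "b \<in> L2_space M"
  shows "(\<lambda>y. a y * b y) \<in> L2_space M"
    and "L2_norm M (\<lambda>y. a y * b y) = L2_norm M a * L2_norm M b"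
proof -
  have "indep_var borel ((\<lambda>x. x\<^sup>2) \<circ> a) borel ((\<lambda>x. x\<^sup>2) \<circ> b)"
    by (rule indep_var_compose[OF assms(1)]) simp_all
  hence ind: "indep_var borel (\<lambda>y. (a y)\<^sup>2) borel (\<lambda>y. (b y)\<^sup>2)" by (simp add: comp_def)
  have int: "integrable M (\<lambda>y. (a y)\<^sup>2)" "integrable M (\<lambda>y. (b y)\<^sup>2)"
    using assms by (auto simp: L2_space_def)
  show "(\<lambda>y. a y * b y) \<in> L2_space M"
    using assms indep_var_integrable[OF ind int] by (auto simp: L2_space_def power_mult_distrib)
  show "L2_norm M (\<lambda>y. a y * b y) = L2_norm M a * L2_norm M b"
    using indep_var_lebesgue_integral[OF ind int]
    by (simp add: L2_norm_def power_mult_distrib real_sqrt_mult)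
qed

lemma variation_mult_independent:
  assumes A: "A \<subseteq> L2_space M" and B: "B \<subseteq> L2_space M" and "independent_sets M A B"
  shows "AE y in M. variation M (A * B) y = variation M A y * variation M B y"
proof (rule variation_mult[OF A B])
  have "indep_var borel a borel b" if "a \<in> A" "b \<in> B" for a b
    using assms(3) that by (simp add: independent_sets_def)
  note ind = indep_var_L2_mult[OF this]
  show "A * B \<subseteq> L2_space M" using A B ind(1) by (auto simp: set_times_def times_fun_def)
  show "L2_norm M (\<lambda>y. a y * b y) = L2_norm M a * L2_norm M b" if "a \<in> A" "b \<in> B" for a b
    using that A B by (intro ind(2)) auto
qed

end

section \<open>Elementary tensors\<close>

lemma (in prob_space) distr_pair_snd:
  assumes "sigma_finite_measure N" shows "distr (M \<Otimes>\<^sub>M N) N snd = N"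
proof (intro measure_eqI)
  interpret N: sigma_finite_measure N by fact
  fix A assume A: "A \<in> sets (distr (M \<Otimes>\<^sub>M N) N snd)"
  hence "emeasure (distr (M \<Otimes>\<^sub>M N) N snd) A = emeasure (M \<Otimes>\<^sub>M N) (space M \<times> A)"
    by (auto simp add: emeasure_distr space_pair_measure dest: sets.sets_into_space
      intro!: arg_cong2[where f=emeasure])
  with A show "emeasure (distr (M \<Otimes>\<^sub>M N) N snd) A = emeasure N A"
    by (simp add: N.emeasure_pair_measure_Times emeasure_space_1)
qed simp

lemma measure_preserving_L2:
  assumes T: "T \<in> measurable N M" "distr N M T = M" and a: "a \<in> L2_space M"
  shows "(\<lambda>z. a (T z)) \<in> L2_space N" "L2_norm N (\<lambda>z. a (T z)) = L2_norm M a"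
proof -
  note [measurable] = T(1) L2_spaceD(1)[OF a]
  have "integrable (distr N M T) (\<lambda>y. (a y)\<^sup>2)" using a T(2) by (simp add: L2_space_def)
  thus "(\<lambda>z. a (T z)) \<in> L2_space N"
    by (subst (asm) integrable_distr_eq) (auto simp: L2_space_def)
  have "(\<integral>y. (a y)\<^sup>2 \<partial>distr N M T) = (\<integral>z. (a (T z))\<^sup>2 \<partial>N)" by (rule integral_distr) simp_all
  thus "L2_norm N (\<lambda>z. a (T z)) = L2_norm M a" by (simp add: T(2) L2_norm_def)
qed

lemma measure_preserving_AE:
  assumes "T \<in> measurable N M" "distr N M T = M" "AE y in M. P y"
  shows "AE z in N. P (T z)"
  using AE_distrD[OF assms(1), of P] assms(3) unfolding assms(2) by blast

text \<open>
  The essential supremum over \<open>N\<close> could a priori be smaller than the pullback of the one over \<open>M\<close>,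
  because it competes with functions that do not factor through \<open>T\<close>; that the supremum is attained
  by a countable subfamily, hence pointwise, excludes this.
\<close>

lemma variation_measure_preserving:
  assumes "prob_space M" "prob_space N" and T: "T \<in> measurable N M" "distr N M T = M"
    and A: "A \<subseteq> L2_space M"
  shows "AE z in N. variation N ((\<lambda>a z. a (T z)) ` A) z = variation M A (T z)"
proof -
  interpret M: prob_space M by fact
  interpret N: prob_space N by fact
  note L2 = measure_preserving_L2[OF T]
  have AN: "(\<lambda>a z. a (T z)) ` A \<subseteq> L2_space N" using A L2(1) by auto
  have "AE z in N. variation N ((\<lambda>a z. a (T z)) ` A) z \<le> variation M A (T z)"
  proof (subst N.variation_le_iff[OF AN])
    show "(\<lambda>z. variation M A (T z)) \<in> borel_measurable N"
      using T(1) M.variation_measurable[OF A] by measurable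
    show "\<forall>u\<in>(\<lambda>a z. a (T z)) ` A. AE z in N. ennreal ((u z)\<^sup>2)
        \<le> ennreal ((L2_norm N u)\<^sup>2) * variation M A (T z)"
    proof
      fix u assume "u \<in> (\<lambda>a z. a (T z)) ` A"
      then obtain a where a: "a \<in> A" "u = (\<lambda>z. a (T z))" by blast
      thus "AE z in N. ennreal ((u z)\<^sup>2) \<le> ennreal ((L2_norm N u)\<^sup>2) * variation M A (T z)"
        using measure_preserving_AE[OF T M.square_le_variation[OF A a(1)]] L2(2)[of a] A by auto
    qed
  qed
  moreover have "AE z in N. variation M A (T z) \<le> variation N ((\<lambda>a z. a (T z)) ` A) z"
  proof -
    obtain C where C: "C \<subseteq> A" "countable C"
      "AE y in M. variation M A y = (SUP u\<in>C. ennreal ((u y / L2_norm M u)\<^sup>2))"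
      by (rule M.variation_eq_countable_SUP[OF A])
    have "AE z in N. ennreal ((u (T z) / L2_norm M u)\<^sup>2) \<le> variation N ((\<lambda>a z. a (T z)) ` A) z"
      if "u \<in> C" for u
    proof -
      have u: "u \<in> A" "u \<in> L2_space M" using that C(1) A by auto
      show ?thesis
        using N.normalized_square_le_variation[OF AN imageI[OF u(1)]] unfolding L2(2)[OF u(2)] .
    qed
    hence "AE z in N. \<forall>u\<in>C. ennreal ((u (T z) / L2_norm M u)\<^sup>2) \<le> variation N ((\<lambda>a z. a (T z)) ` A) z"
      using C(2) by (simp add: AE_ball_countable)
    with measure_preserving_AE[OF T C(3)] show ?thesis
      by eventually_elim (auto intro: SUP_least)
  qed
  ultimately show ?thesis by eventually_elim (rule antisym)
qed

context prob_space
begin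

lemma pair_prob_space_self: "prob_space (M \<Otimes>\<^sub>M M)"
proof -
  interpret P: pair_prob_space M M ..
  show ?thesis by unfold_locales
qed

lemma fst_measure_preserving: "fst \<in> measurable (M \<Otimes>\<^sub>M M) M" "distr (M \<Otimes>\<^sub>M M) M fst = M"
  by (simp_all add: distr_pair_fst)

lemma snd_measure_preserving: "snd \<in> measurable (M \<Otimes>\<^sub>M M) M" "distr (M \<Otimes>\<^sub>M M) M snd = M"
  using distr_pair_snd[OF sigma_finite_measure_axioms] by simp_all

lemma indep_var_fst_snd:
  fixes a b :: "'a \<Rightarrow> real"
  assumes [measurable]: "a \<in> borel_measurable M" "b \<in> borel_measurable M"
  shows "prob_space.indep_var (M \<Otimes>\<^sub>M M) borel (\<lambda>z. a (fst z)) borel (\<lambda>z. b (snd z))"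
proof -
  interpret N: prob_space "M \<Otimes>\<^sub>M M" by (rule pair_prob_space_self)
  have "distr (distr (M \<Otimes>\<^sub>M M) M fst) borel a = distr (M \<Otimes>\<^sub>M M) borel (\<lambda>z. a (fst z))"
    "distr (distr (M \<Otimes>\<^sub>M M) M snd) borel b = distr (M \<Otimes>\<^sub>M M) borel (\<lambda>z. b (snd z))"
    by (simp_all add: distr_distr comp_def)
  moreover have "distr M borel a \<Otimes>\<^sub>M distr M borel b
      = distr (M \<Otimes>\<^sub>M M) (borel \<Otimes>\<^sub>M borel) (\<lambda>(x, y). (a x, b y))"
    by (intro pair_measure_distr prob_space_imp_sigma_finite prob_space_distr) simp_all
  ultimately show ?thesis
    by (simp add: N.indep_var_distribution_eq fst_measure_preserving snd_measure_preserving case_prod_unfold)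
qed

lemma integral_fst_mult_snd:
  fixes p q :: "'a \<Rightarrow> real"
  assumes "integrable M p" "integrable M q"
  shows "integrable (M \<Otimes>\<^sub>M M) (\<lambda>z. p (fst z) * q (snd z))"
    and "(\<integral>z. p (fst z) * q (snd z) \<partial>(M \<Otimes>\<^sub>M M)) = (\<integral>y. p y \<partial>M) * (\<integral>y. q y \<partial>M)"
proof -
  interpret N: prob_space "M \<Otimes>\<^sub>M M" by (rule pair_prob_space_self)
  note [measurable] = assms[THEN borel_measurable_integrable]
  have "integrable (distr (M \<Otimes>\<^sub>M M) M fst) p" "integrable (distr (M \<Otimes>\<^sub>M M) M snd) q"
    using assms by (simp_all add: fst_measure_preserving snd_measure_preserving)
  hence int: "integrable (M \<Otimes>\<^sub>M M) (\<lambda>z. p (fst z))" "integrable (M \<Otimes>\<^sub>M M) (\<lambda>z. q (snd z))"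
    by (simp_all add: integrable_distr_eq)
  have ind: "N.indep_var borel (\<lambda>z. p (fst z)) borel (\<lambda>z. q (snd z))" by (rule indep_var_fst_snd) simp_all
  show "integrable (M \<Otimes>\<^sub>M M) (\<lambda>z. p (fst z) * q (snd z))"
    by (rule N.indep_var_integrable[OF ind int])
  have "(\<integral>y. p y \<partial>distr (M \<Otimes>\<^sub>M M) M fst) = (\<integral>z. p (fst z) \<partial>(M \<Otimes>\<^sub>M M))"
    "(\<integral>y. q y \<partial>distr (M \<Otimes>\<^sub>M M) M snd) = (\<integral>z. q (snd z) \<partial>(M \<Otimes>\<^sub>M M))"
    by (simp_all add: integral_distr)
  thus "(\<integral>z. p (fst z) * q (snd z) \<partial>(M \<Otimes>\<^sub>M M)) = (\<integral>y. p y \<partial>M) * (\<integral>y. q y \<partial>M)"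
    using N.indep_var_lebesgue_integral[OF ind int]
    by (simp add: fst_measure_preserving snd_measure_preserving)
qed

lemma elementary_tensors_eq_mult:
  "elementary_tensors A B = (\<lambda>a z. a (fst z)) ` A * (\<lambda>b z. b (snd z)) ` B"
  by (auto simp: elementary_tensors_def set_times_def times_fun_def)

lemma elementary_tensors_L2:
  assumes A: "A \<subseteq> L2_space M" and B: "B \<subseteq> L2_space M"
  shows "elementary_tensors A B \<subseteq> L2_space (M \<Otimes>\<^sub>M M)"
proof -
  interpret N: prob_space "M \<Otimes>\<^sub>M M" by (rule pair_prob_space_self)
  have "(\<lambda>z. a (fst z) * b (snd z)) \<in> L2_space (M \<Otimes>\<^sub>M M)" if "a \<in> A" "b \<in> B" for a b
    using that A B measure_preserving_L2(1)[OF fst_measure_preserving, of a]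
      measure_preserving_L2(1)[OF snd_measure_preserving, of b]
    by (intro N.indep_var_L2_mult indep_var_fst_snd) (auto simp: L2_space_def)
  thus ?thesis by (auto simp: elementary_tensors_def)
qed

lemma variation_elementary_tensors:
  assumes A: "A \<subseteq> L2_space M" and B: "B \<subseteq> L2_space M"
  shows "AE z in M \<Otimes>\<^sub>M M. variation (M \<Otimes>\<^sub>M M) (elementary_tensors A B) z
    = variation M A (fst z) * variation M B (snd z)"
proof -
  interpret N: prob_space "M \<Otimes>\<^sub>M M" by (rule pair_prob_space_self)
  let ?A = "(\<lambda>a (z :: 'a \<times> 'a). a (fst z)) ` A" and ?B = "(\<lambda>b (z :: 'a \<times> 'a). b (snd z)) ` B"
  have "AE z in M \<Otimes>\<^sub>M M. variation (M \<Otimes>\<^sub>M M) (?A * ?B) z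
      = variation (M \<Otimes>\<^sub>M M) ?A z * variation (M \<Otimes>\<^sub>M M) ?B z"
  proof (rule N.variation_mult_independent)
    show "?A \<subseteq> L2_space (M \<Otimes>\<^sub>M M)" "?B \<subseteq> L2_space (M \<Otimes>\<^sub>M M)"
      using A B measure_preserving_L2(1)[OF fst_measure_preserving]
        measure_preserving_L2(1)[OF snd_measure_preserving] by auto
    show "independent_sets (M \<Otimes>\<^sub>M M) ?A ?B"
      using A B by (auto simp: independent_sets_def L2_space_def intro!: indep_var_fst_snd)
  qed
  with variation_measure_preserving[OF prob_space_axioms pair_prob_space_self fst_measure_preserving A]
    variation_measure_preserving[OF prob_space_axioms pair_prob_space_self snd_measure_preserving B]
  show ?thesis unfolding elementary_tensors_eq_mult by eventually_elim simp
qed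

end

section \<open>Tensor products of subspaces\<close>

context prob_space
begin

lemma subspace_sum_scale:
  assumes "fun_space.subspace B" "\<And>e. e \<in> E \<Longrightarrow> \<beta> e \<in> B"
  shows "(\<lambda>y. \<Sum>e\<in>E. c e * \<beta> e y) \<in> B"
proof -
  have "(\<Sum>e\<in>E. fscale (c e) (\<beta> e)) \<in> B"
    using assms by (intro fun_space.subspace_sum fun_space.subspace_scale) auto
  moreover have "(\<Sum>e\<in>E. fscale (c e) (\<beta> e)) = (\<lambda>y. \<Sum>e\<in>E. c e * \<beta> e y)"
    by (induction E rule: infinite_finite_induct) (auto simp: fun_eq_iff fscale_def plus_fun_def zero_fun_def)
  ultimately show ?thesis by simp
qed

definition orthonormal :: "('a \<Rightarrow> real) set \<Rightarrow> bool" where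
  "orthonormal E \<longleftrightarrow> finite E \<and> (\<forall>e\<in>E. \<forall>e'\<in>E. (\<integral>y. e y * e' y \<partial>M) = (if e = e' then 1 else 0))"

lemma orthonormal_coefficient:
  assumes E: "orthonormal E" "E \<subseteq> L2_space M" and e: "e \<in> E"
  shows "(\<integral>y. (\<Sum>e'\<in>E. c e' * e' y) * e y \<partial>M) = c e"
proof -
  have int: "integrable M (\<lambda>y. e' y * e y)" if "e' \<in> E" for e'
    using that e E(2) by (intro L2_space_mult_integrable) auto
  have "(\<integral>y. (\<Sum>e'\<in>E. c e' * e' y) * e y \<partial>M) = (\<integral>y. (\<Sum>e'\<in>E. c e' * (e' y * e y)) \<partial>M)"
    by (simp add: sum_distrib_right mult.assoc)
  also have "\<dots> = (\<Sum>e'\<in>E. c e' * (\<integral>y. e' y * e y \<partial>M))"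
    using int by (subst Bochner_Integration.integral_sum) auto
  also have "\<dots> = (\<Sum>e'\<in>E. if e' = e then c e else 0)"
    using E(1) e by (intro sum.cong) (auto simp: orthonormal_def)
  also have "\<dots> = c e" using E(1) e by (simp add: orthonormal_def)
  finally show ?thesis .
qed

lemma orthonormal_L2_norm:
  assumes E: "orthonormal E" "E \<subseteq> L2_space M"
  shows "(L2_norm M (\<lambda>y. \<Sum>e\<in>E. c e * e y))\<^sup>2 = (\<Sum>e\<in>E. (c e)\<^sup>2)"
proof -
  define s where "s = (\<lambda>y. \<Sum>e\<in>E. c e * e y)"
  have s: "s \<in> L2_space M"
  proof -
    have "finite E" using E(1) by (simp add: orthonormal_def)
    thus ?thesis using E(2) unfolding s_def
      by (induction E rule: finite_induct) (auto simp: L2_space_add L2_space_scale, simp add: L2_space_def)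
  qed
  have int: "integrable M (\<lambda>y. s y * e y)" if "e \<in> E" for e
    using that s E(2) by (intro L2_space_mult_integrable) auto
  have "s y * s y = (\<Sum>e\<in>E. c e * (s y * e y))" for y
  proof -
    have "s y * s y = s y * (\<Sum>e\<in>E. c e * e y)" by (simp add: s_def)
    thus ?thesis by (simp add: sum_distrib_left mult_ac)
  qed
  hence "(L2_norm M s)\<^sup>2 = (\<integral>y. (\<Sum>e\<in>E. c e * (s y * e y)) \<partial>M)"
    unfolding L2_norm_power2 by (simp add: power2_eq_square)
  also have "\<dots> = (\<Sum>e\<in>E. c e * (\<integral>y. s y * e y \<partial>M))"
    using int by (subst Bochner_Integration.integral_sum) auto
  also have "\<dots> = (\<Sum>e\<in>E. (c e)\<^sup>2)"
    using orthonormal_coefficient[OF E, of _ c] by (intro sum.cong) (auto simp: s_def power2_eq_square)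
  finally show ?thesis unfolding s_def .
qed

text \<open>
  One step of the Gram-Schmidt process. Orthonormality only makes sense up to null functions, so a
  remainder that vanishes almost everywhere is dropped.
\<close>

lemma orthonormal_extend:
  assumes B: "fun_space.subspace B" "B \<subseteq> L2_space M" and E: "orthonormal E" "E \<subseteq> B" and b: "b \<in> B"
  obtains E' c where "orthonormal E'" "E \<subseteq> E'" "E' \<subseteq> B" "AE y in M. b y = (\<Sum>e\<in>E'. c e * e y)"
proof -
  have fin: "finite E" and E_L2: "E \<subseteq> L2_space M" using E B by (auto simp: orthonormal_def)
  define d where "d e = (\<integral>y. b y * e y \<partial>M)" for e
  define r where "r = (\<lambda>y. b y - (\<Sum>e\<in>E. d e * e y))"
  have sB: "(\<lambda>y. \<Sum>e\<in>E. d e * e y) \<in> B" using B E by (intro subspace_sum_scale) auto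
  have rB: "r \<in> B"
    using fun_space.subspace_diff[OF B(1) b sB] by (simp add: r_def fun_diff_def)
  hence rL: "r \<in> L2_space M" using B by auto
  have orth: "(\<integral>y. r y * e y \<partial>M) = 0" if "e \<in> E" for e
  proof -
    have "integrable M (\<lambda>y. b y * e y)" "integrable M (\<lambda>y. (\<Sum>e\<in>E. d e * e y) * e y)"
      using that sB b B E by (auto intro!: L2_space_mult_integrable[of "\<lambda>y. \<Sum>e\<in>E. d e * e y"] L2_space_mult_integrable[of b])
    thus ?thesis
      unfolding r_def left_diff_distrib using orthonormal_coefficient[OF E(1) E_L2 that, of d]
      by (simp add: d_def)
  qed
  show ?thesis
  proof (cases "AE y in M. r y = 0")
    case True
    hence "AE y in M. b y = (\<Sum>e\<in>E. d e * e y)" by eventually_elim (simp add: r_def)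
    thus ?thesis using E that by blast
  next
    case False
    hence pos: "0 < L2_norm M r" using L2_norm_pos_iff[OF rL] by simp
    define f where "f = (\<lambda>y. (1 / L2_norm M r) * r y)"
    have fB: "f \<in> B" using fun_space.subspace_scale[OF B(1) rB] unfolding f_def fscale_def .
    have f_orth: "(\<integral>y. f y * e y \<partial>M) = 0" "(\<integral>y. e y * f y \<partial>M) = 0" if "e \<in> E" for e
      using orth[OF that] by (simp_all add: f_def mult.assoc mult.left_commute[of "e _"] mult.commute[of "e _"])
    have "(L2_norm M f)\<^sup>2 = 1" unfolding f_def L2_norm_scale using pos by simp
    hence f1: "(\<integral>y. f y * f y \<partial>M) = 1"
      unfolding L2_norm_power2 by (simp add: power2_eq_square)
    have fE: "f \<notin> E" using f_orth(1)[of f] f1 by auto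
    have "orthonormal (insert f E)"
      using E(1) f_orth f1 fE by (auto simp: orthonormal_def)
    moreover have "b y = (\<Sum>e\<in>insert f E. (if e = f then L2_norm M r else d e) * e y)" for y
    proof -
      have "(\<Sum>e\<in>E. (if e = f then L2_norm M r else d e) * e y) = (\<Sum>e\<in>E. d e * e y)"
        using fE by (intro sum.cong) auto
      moreover have "L2_norm M r * f y = r y" using pos by (simp add: f_def)
      ultimately show ?thesis using fin fE by (simp add: r_def)
    qed
    ultimately show ?thesis
      using that[of "insert f E" "\<lambda>e. if e = f then L2_norm M r else d e"] fB E(2) by auto
  qed
qed

text \<open>
  Each new elementary tensor \<open>a \<otimes> b\<close> may enlarge the orthonormal family by one function; the
  coefficients of \<open>b\<close> in the enlarged family, times \<open>a\<close>, are added to the \<open>\<alpha>\<^sub>e\<close>. The identity holds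
  only almost everywhere because remainders that are null functions were dropped.
\<close>

lemma tensor_orthonormal_expansion:
  assumes A: "fun_space.subspace A" and B: "fun_space.subspace B" "B \<subseteq> L2_space M"
    and f: "f \<in> tensor_product A B"
  shows "\<exists>E \<alpha>. orthonormal E \<and> E \<subseteq> B \<and> (\<forall>e. \<alpha> e \<in> A) \<and>
    (AE z in M \<Otimes>\<^sub>M M. f z = (\<Sum>e\<in>E. \<alpha> e (fst z) * e (snd z)))"
  using f unfolding tensor_product_def
proof (induction rule: fun_space.span_induct_alt)
  case base
  show ?case
    using fun_space.subspace_0[OF A]
    by (intro exI[of _ "{}"] exI[of _ "\<lambda>_. 0"]) (simp add: orthonormal_def zero_fun_def)
next
  case (step k x g)
  then obtain E \<alpha> where E: "orthonormal E" "E \<subseteq> B" and \<alpha>: "\<And>e. \<alpha> e \<in> A"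
    and g: "AE z in M \<Otimes>\<^sub>M M. g z = (\<Sum>e\<in>E. \<alpha> e (fst z) * e (snd z))" by blast
  obtain a b where ab: "a \<in> A" "b \<in> B" "x = (\<lambda>z. a (fst z) * b (snd z))"
    using step(1) by (auto simp: elementary_tensors_def)
  obtain E' c where E': "orthonormal E'" "E \<subseteq> E'" "E' \<subseteq> B"
    and c: "AE y in M. b y = (\<Sum>e\<in>E'. c e * e y)"
    by (rule orthonormal_extend[OF B E ab(2)])
  define \<alpha>' where "\<alpha>' e = (\<lambda>y. (if e \<in> E then 1 else 0) * \<alpha> e y + (k * c e) * a y)" for e
  have "\<alpha>' e \<in> A" for e
    using fun_space.subspace_add[OF A fun_space.subspace_scale[OF A \<alpha>[of e]] fun_space.subspace_scale[OF A ab(1)]]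
    by (simp add: \<alpha>'_def fscale_def plus_fun_def)
  moreover have "AE z in M \<Otimes>\<^sub>M M. (fscale k x + g) z = (\<Sum>e\<in>E'. \<alpha>' e (fst z) * e (snd z))"
    using g measure_preserving_AE[OF snd_measure_preserving c]
  proof eventually_elim
    case (elim z)
    have fin: "finite E'" using E'(1) by (simp add: orthonormal_def)
    have "(\<Sum>e\<in>E'. \<alpha>' e (fst z) * e (snd z)) =
        (\<Sum>e\<in>E'. (if e \<in> E then \<alpha> e (fst z) * e (snd z) else 0) + k * a (fst z) * (c e * e (snd z)))"
      by (intro sum.cong) (auto simp: \<alpha>'_def algebra_simps)
    also have "\<dots> = (\<Sum>e\<in>E. \<alpha> e (fst z) * e (snd z)) + k * a (fst z) * (\<Sum>e\<in>E'. c e * e (snd z))"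
      using fin E'(2) by (simp add: sum.distrib sum_distrib_left sum.If_cases Int_absorb1)
    also have "\<dots> = (fscale k x + g) z" using elim by (simp add: fscale_def plus_fun_def ab(3))
    finally show ?case by simp
  qed
  ultimately show ?case using E' by blast
qed

lemma L2_space_subspace: "fun_space.subspace (L2_space M)"
  by (auto simp: fun_space.subspace_def plus_fun_def zero_fun_def fscale_def
      intro!: L2_space_add L2_space_scale) (simp add: L2_space_def)

end

lemma tensor_product_L2:
  assumes "prob_space M" "A \<subseteq> L2_space M" "B \<subseteq> L2_space M"
  shows "tensor_product A B \<subseteq> L2_space (M \<Otimes>\<^sub>M M)"
  unfolding tensor_product_def
  using prob_space.elementary_tensors_L2[OF assms]
    prob_space.L2_space_subspace[OF prob_space.pair_prob_space_self[OF assms(1)]]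
  by (rule fun_space.span_minimal)

context prob_space
begin

text \<open>
  With \<open>f = \<Sum> \<alpha>\<^sub>e \<otimes> e\<close> and orthonormal \<open>e\<close>, a slice \<open>f (x, \<cdot>)\<close> lies in \<open>B\<close> and has squared norm
  \<open>\<Sum> \<bar>\<alpha>\<^sub>e x\<bar>\<^sup>2\<close>, which for almost every \<open>x\<close> is at most \<open>\<Sum> \<parallel>\<alpha>\<^sub>e\<parallel>\<^sup>2 = \<parallel>f\<parallel>\<^sup>2\<close> times the variation of \<open>A\<close>
  at \<open>x\<close>. Fubini's theorem combines the two bounds, the null set in \<open>y\<close> being allowed to depend on \<open>x\<close>.
\<close>

lemma square_le_variation_tensor:
  assumes A: "fun_space.subspace A" "A \<subseteq> L2_space M" and B: "fun_space.subspace B" "B \<subseteq> L2_space M"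
    and f: "f \<in> tensor_product A B"
  shows "AE z in M \<Otimes>\<^sub>M M. ennreal ((f z)\<^sup>2) \<le>
    ennreal ((L2_norm (M \<Otimes>\<^sub>M M) f)\<^sup>2) * (variation M A (fst z) * variation M B (snd z))"
proof -
  interpret P: pair_prob_space M M ..
  note [measurable] = variation_measurable[OF A(2)] variation_measurable[OF B(2)]
  obtain E \<alpha> where E: "orthonormal E" "E \<subseteq> B" and \<alpha>: "\<And>e. \<alpha> e \<in> A"
    and fE: "AE z in M \<Otimes>\<^sub>M M. f z = (\<Sum>e\<in>E. \<alpha> e (fst z) * e (snd z))"
    using tensor_orthonormal_expansion[OF A(1) B f] by blast
  define g where "g z = (\<Sum>e\<in>E. \<alpha> e (fst z) * e (snd z))" for z
  have fin: "finite E" and E_L2: "\<And>e. e \<in> E \<Longrightarrow> e \<in> L2_space M" and \<alpha>_L2: "\<And>e. \<alpha> e \<in> L2_space M"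
    using E A B \<alpha> by (auto simp: orthonormal_def)
  have [measurable]: "\<alpha> e \<in> borel_measurable M" for e using \<alpha>_L2 by (rule L2_spaceD)
  have [measurable]: "e \<in> borel_measurable M" if "e \<in> E" for e using E_L2[OF that] by (rule L2_spaceD)
  have g_meas[measurable]: "g \<in> borel_measurable (M \<Otimes>\<^sub>M M)" unfolding g_def by measurable
  have f_meas: "f \<in> borel_measurable (M \<Otimes>\<^sub>M M)"
    using tensor_product_L2[OF prob_space_axioms A(2) B(2)] f by (auto simp: L2_space_def)
  have prod_int: "integrable (M \<Otimes>\<^sub>M M) (\<lambda>z. \<alpha> e (fst z) * \<alpha> e' (fst z) * (e (snd z) * e' (snd z)))"
    "(\<integral>z. \<alpha> e (fst z) * \<alpha> e' (fst z) * (e (snd z) * e' (snd z)) \<partial>(M \<Otimes>\<^sub>M M))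
      = (\<integral>y. \<alpha> e y * \<alpha> e' y \<partial>M) * (\<integral>y. e y * e' y \<partial>M)"
    if "e \<in> E" "e' \<in> E" for e e'
    using integral_fst_mult_snd[OF L2_space_mult_integrable[OF \<alpha>_L2 \<alpha>_L2]
        L2_space_mult_integrable[OF E_L2[OF that(1)] E_L2[OF that(2)]]] by blast+
  have "(L2_norm (M \<Otimes>\<^sub>M M) f)\<^sup>2 = (L2_norm (M \<Otimes>\<^sub>M M) g)\<^sup>2"
    using L2_norm_cong_AE[OF f_meas g_meas] fE by (simp add: g_def)
  also have "\<dots> = (\<integral>z. (\<Sum>e\<in>E. \<Sum>e'\<in>E. (\<alpha> e (fst z) * \<alpha> e' (fst z)) * (e (snd z) * e' (snd z))) \<partial>(M \<Otimes>\<^sub>M M))"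
    unfolding L2_norm_power2 by (simp add: g_def power2_eq_square sum_product mult_ac)
  also have "\<dots> = (\<Sum>e\<in>E. \<Sum>e'\<in>E. (\<integral>y. \<alpha> e y * \<alpha> e' y \<partial>M) * (\<integral>y. e y * e' y \<partial>M))"
    using prod_int by (simp add: Bochner_Integration.integral_sum)
  also have "\<dots> = (\<Sum>e\<in>E. \<Sum>e'\<in>E. if e = e' then (L2_norm M (\<alpha> e))\<^sup>2 else 0)"
    using E(1) by (intro sum.cong) (auto simp: orthonormal_def L2_norm_power2, simp add: power2_eq_square)
  also have "\<dots> = (\<Sum>e\<in>E. (L2_norm M (\<alpha> e))\<^sup>2)" using fin by simp
  finally have norm_f: "(L2_norm (M \<Otimes>\<^sub>M M) f)\<^sup>2 = (\<Sum>e\<in>E. (L2_norm M (\<alpha> e))\<^sup>2)" .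
  have slice: "AE y in M. ennreal ((g (x, y))\<^sup>2) \<le> ennreal (\<Sum>e\<in>E. (\<alpha> e x)\<^sup>2) * variation M B y" for x
  proof -
    have "(\<lambda>y. \<Sum>e\<in>E. \<alpha> e x * e y) \<in> B" using B(1) E(2) by (intro subspace_sum_scale) auto
    from square_le_variation[OF B(2) this] show ?thesis
      using E E_L2 by (subst (asm) orthonormal_L2_norm) (auto simp: g_def)
  qed
  have "AE x in M. \<forall>e\<in>E. ennreal ((\<alpha> e x)\<^sup>2) \<le> ennreal ((L2_norm M (\<alpha> e))\<^sup>2) * variation M A x"
    using fin square_le_variation[OF A(2) \<alpha>] by (simp add: AE_ball_countable countable_finite)
  hence "AE x in M. ennreal (\<Sum>e\<in>E. (\<alpha> e x)\<^sup>2) \<le> ennreal (\<Sum>e\<in>E. (L2_norm M (\<alpha> e))\<^sup>2) * variation M A x"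
  proof eventually_elim
    case (elim x)
    hence "(\<Sum>e\<in>E. ennreal ((\<alpha> e x)\<^sup>2)) \<le> (\<Sum>e\<in>E. ennreal ((L2_norm M (\<alpha> e))\<^sup>2) * variation M A x)"
      by (intro sum_mono) auto
    thus ?case by (simp add: sum_distrib_right[symmetric])
  qed
  hence "AE x in M. AE y in M. ennreal ((g (x, y))\<^sup>2) \<le>
      ennreal ((L2_norm (M \<Otimes>\<^sub>M M) f)\<^sup>2) * (variation M A x * variation M B y)"
  proof eventually_elim
    case (elim x)
    show ?case using slice[of x]
    proof eventually_elim
      case (elim y)
      also have "ennreal (\<Sum>e\<in>E. (\<alpha> e x)\<^sup>2) * variation M B y
          \<le> (ennreal ((L2_norm (M \<Otimes>\<^sub>M M) f)\<^sup>2) * variation M A x) * variation M B y"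
        unfolding norm_f using \<open>ennreal (\<Sum>e\<in>E. (\<alpha> e x)\<^sup>2) \<le> _\<close> by (rule mult_right_mono) simp
      finally show ?case by (simp add: mult.assoc)
    qed
  qed
  hence "AE z in M \<Otimes>\<^sub>M M. ennreal ((g z)\<^sup>2) \<le>
      ennreal ((L2_norm (M \<Otimes>\<^sub>M M) f)\<^sup>2) * (variation M A (fst z) * variation M B (snd z))"
    by (intro P.AE_pair_measure) simp_all
  with fE show ?thesis by eventually_elim (simp add: g_def)
qed

lemma variation_tensor_product:
  assumes A: "fun_space.subspace A" "A \<subseteq> L2_space M" and B: "fun_space.subspace B" "B \<subseteq> L2_space M"
  shows "AE z in M \<Otimes>\<^sub>M M. variation (M \<Otimes>\<^sub>M M) (tensor_product A B) z
    = variation M A (fst z) * variation M B (snd z)"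
proof -
  interpret N: prob_space "M \<Otimes>\<^sub>M M" by (rule pair_prob_space_self)
  note L2 = tensor_product_L2[OF prob_space_axioms A(2) B(2)]
  note [measurable] = variation_measurable[OF A(2)] variation_measurable[OF B(2)]
  have "AE z in M \<Otimes>\<^sub>M M. variation (M \<Otimes>\<^sub>M M) (tensor_product A B) z
      \<le> variation M A (fst z) * variation M B (snd z)"
    using square_le_variation_tensor[OF A B] by (subst N.variation_le_iff[OF L2]) auto
  moreover have "AE z in M \<Otimes>\<^sub>M M. variation (M \<Otimes>\<^sub>M M) (elementary_tensors A B) z
      \<le> variation (M \<Otimes>\<^sub>M M) (tensor_product A B) z"
    using L2 by (intro N.variation_mono) (auto simp: tensor_product_def fun_space.span_base)
  ultimately show ?thesis using variation_elementary_tensors[OF A(2) B(2)]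
    by eventually_elim (metis order_antisym)
qed

end

section \<open>Pseudometric topologies and the Hausdorff distance\<close>

lemma openin_pseudometric_ball:
  "x \<in> S \<Longrightarrow> 0 < e \<Longrightarrow> openin (pseudometric_topology S d) {y \<in> S. d x y < e}"
  unfolding pseudometric_topology_def by (rule topology_generated_by_Basis) blast

lemma topspace_pseudometric:
  assumes "\<And>x. x \<in> S \<Longrightarrow> d x x = 0"
  shows "topspace (pseudometric_topology S d) = S"
proof -
  have "x \<in> topspace (pseudometric_topology S d)" if "x \<in> S" for x
    using openin_subset[OF openin_pseudometric_ball[OF that, of 1 d]] assms[OF that] that by auto
  moreover have "topspace (pseudometric_topology S d) \<subseteq> S"
    unfolding pseudometric_topology_def topology_generated_by_topspace by auto
  ultimately show ?thesis by blast
qed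

lemma closure_of_pseudometricD:
  assumes "\<And>x. x \<in> S \<Longrightarrow> d x x = 0" "x \<in> pseudometric_topology S d closure_of A" "0 < e"
  obtains a where "a \<in> A" "a \<in> S" "d x a < e"
proof -
  have "x \<in> S" using assms(2) topspace_pseudometric[of S d] assms(1) by (auto simp: in_closure_of)
  hence "openin (pseudometric_topology S d) {y \<in> S. d x y < e}" "x \<in> {y \<in> S. d x y < e}"
    using assms openin_pseudometric_ball[of x S e d] by auto
  moreover have "\<exists>y. y \<in> A \<and> y \<in> T"
    if "x \<in> T" "openin (pseudometric_topology S d) T" for T
    using assms(2) that by (simp add: in_closure_of)
  ultimately obtain a where "a \<in> A" "a \<in> {y \<in> S. d x y < e}" by metis
  thus ?thesis by (intro that[of a]) simp_all
qed

lemma openin_pseudometricI: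
  assumes refl: "\<And>x. x \<in> S \<Longrightarrow> d x x = 0" and "U \<subseteq> S"
    and ball: "\<And>x. x \<in> U \<Longrightarrow> \<exists>e>0. \<forall>y\<in>S. d x y < e \<longrightarrow> y \<in> U"
  shows "openin (pseudometric_topology S d) U"
proof (subst openin_subopen, intro ballI)
  fix x assume x: "x \<in> U"
  then obtain e where e: "0 < e" "\<And>y. y \<in> S \<Longrightarrow> d x y < e \<Longrightarrow> y \<in> U" using ball by blast
  have xS: "x \<in> S" using x \<open>U \<subseteq> S\<close> by blast
  show "\<exists>T. openin (pseudometric_topology S d) T \<and> x \<in> T \<and> T \<subseteq> U"
    using openin_pseudometric_ball[OF xS e(1)] e xS refl[OF xS]
    by (intro exI[of _ "{y \<in> S. d x y < e}"]) auto
qed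

text \<open>
  The topologies are generated by the balls as a subbase, so it suffices to pull back single balls
  of the target. The triangle inequality there makes such a preimage a neighbourhood of each of its
  points. Openness of \<open>F\<close> and continuity on \<open>F\<close> come from the same \<open>\<epsilon>\<close>-\<open>\<delta>\<close> condition, in which
  the nearby points range over all of \<open>S\<close>.
\<close>

lemma pseudometric_open_and_continuous:
  assumes refl: "\<And>x. x \<in> S \<Longrightarrow> d x x = 0" and "F \<subseteq> S"
    and refl': "\<And>x. x \<in> S' \<Longrightarrow> d' x x = 0"
    and tri: "\<And>x y z. x \<in> S' \<Longrightarrow> y \<in> S' \<Longrightarrow> z \<in> S' \<Longrightarrow> d' x z \<le> d' x y + d' y z"
    and f: "f ` F \<subseteq> S'"
    and cont: "\<And>x e. x \<in> F \<Longrightarrow> 0 < e \<Longrightarrow> \<exists>\<delta>>0. \<forall>y\<in>S. d x y < \<delta> \<longrightarrow> y \<in> F \<and> d' (f x) (f y) < e"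
  shows "openin (pseudometric_topology S d) F"
    and "continuous_map (subtopology (pseudometric_topology S d) F) (pseudometric_topology S' d') f"
proof -
  show opF: "openin (pseudometric_topology S d) F"
    using cont[of _ 1] by (intro openin_pseudometricI refl \<open>F \<subseteq> S\<close>) (auto, meson)
  have top: "topspace (subtopology (pseudometric_topology S d) F) = F"
    using topspace_pseudometric[of S d] refl \<open>F \<subseteq> S\<close> by auto
  have "f ` F \<subseteq> \<Union> {{y \<in> S'. d' x y < e} |x e. x \<in> S' \<and> 0 < e}"
  proof
    fix y assume "y \<in> f ` F"
    hence "y \<in> S'" using f by blast
    hence "y \<in> {z \<in> S'. d' y z < 1}" using refl' by simp
    moreover have "{z \<in> S'. d' y z < 1} \<in> {{y \<in> S'. d' x y < e} |x e. x \<in> S' \<and> 0 < e}"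
      using \<open>y \<in> S'\<close> by (intro CollectI exI[of _ y] exI[of _ "1 :: ennreal"]) simp
    ultimately show "y \<in> \<Union> {{y \<in> S'. d' x y < e} |x e. x \<in> S' \<and> 0 < e}" by (rule UnionI[rotated])
  qed
  moreover have "openin (subtopology (pseudometric_topology S d) F) (f -` {y \<in> S'. d' x y < e} \<inter> F)"
    if "x \<in> S'" for x e
  proof -
    have "openin (pseudometric_topology S d) (f -` {y \<in> S'. d' x y < e} \<inter> F)"
    proof (rule openin_pseudometricI[OF refl])
      show "f -` {y \<in> S'. d' x y < e} \<inter> F \<subseteq> S" using \<open>F \<subseteq> S\<close> by blast
      fix z assume "z \<in> f -` {y \<in> S'. d' x y < e} \<inter> F"
      hence z: "z \<in> F" "d' x (f z) < e" "f z \<in> S'" using f by auto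
      have "0 < e - d' x (f z)" using z(2) by (simp add: diff_gr0_ennreal)
      from cont[OF z(1) this] obtain \<delta>
        where \<delta>: "0 < \<delta>" "\<And>y. y \<in> S \<Longrightarrow> d z y < \<delta> \<Longrightarrow> y \<in> F \<and> d' (f z) (f y) < e - d' x (f z)"
        by blast
      have "y \<in> f -` {y \<in> S'. d' x y < e} \<inter> F" if "y \<in> S" "d z y < \<delta>" for y
      proof -
        have y: "y \<in> F" "d' (f z) (f y) < e - d' x (f z)" "f y \<in> S'" using \<delta>(2)[OF that] f by auto
        have "d' x (f y) \<le> d' x (f z) + d' (f z) (f y)" using \<open>x \<in> S'\<close> z y by (intro tri)
        also have "\<dots> < d' x (f z) + (e - d' x (f z))"
          using y(2) z(2) by (intro ennreal_add_left_cancel_less[THEN iffD2]) auto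
        also have "\<dots> = e" using z(2) by (intro add_diff_inverse_ennreal) simp
        finally show ?thesis using y by simp
      qed
      thus "\<exists>e'>0. \<forall>y\<in>S. d z y < e' \<longrightarrow> y \<in> f -` {y \<in> S'. d' x y < e} \<inter> F" using \<delta>(1) by blast
    qed
    thus ?thesis using openin_subset_topspace_eq opF
      by (metis inf_le2 openin_open_subtopology)
  qed
  ultimately show "continuous_map (subtopology (pseudometric_topology S d) F) (pseudometric_topology S' d') f"
    unfolding pseudometric_topology_def[of S'] continuous_on_generated_topo_iff top by auto
qed

lemma hausdorff_dist_self:
  assumes "\<And>x. x \<in> X \<Longrightarrow> d x x = 0"
  shows "hausdorff_dist d X X = 0"
proof -
  have "(INF z\<in>X. d x z) \<le> 0" "(INF z\<in>X. d z x) \<le> 0" if "x \<in> X" for x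
    using INF_lower[OF that, of "d x"] INF_lower[OF that, of "\<lambda>z. d z x"] assms[OF that] by auto
  hence "(SUP x\<in>X. INF z\<in>X. d x z) \<le> 0" "(SUP z\<in>X. INF x\<in>X. d x z) \<le> 0"
    by (blast intro: SUP_least)+
  thus ?thesis by (simp add: hausdorff_dist_def)
qed

lemma hausdorff_dist_lessD:
  assumes "hausdorff_dist d X Z < e"
  shows "x \<in> X \<Longrightarrow> \<exists>z\<in>Z. d x z < e" "z \<in> Z \<Longrightarrow> \<exists>x\<in>X. d x z < e"
proof -
  have s: "(SUP x\<in>X. INF z\<in>Z. d x z) < e" "(SUP z\<in>Z. INF x\<in>X. d x z) < e"
    using assms by (auto simp: hausdorff_dist_def)
  show "\<exists>z\<in>Z. d x z < e" if "x \<in> X"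
    using le_less_trans[OF SUP_upper[OF that] s(1)] by (simp add: INF_less_iff)
  show "\<exists>x\<in>X. d x z < e" if "z \<in> Z"
    using le_less_trans[OF SUP_upper[OF that] s(2)] by (simp add: INF_less_iff)
qed

section \<open>The weighted norm\<close>

lemma wnorm_le_iff:
  assumes [measurable]: "w \<in> borel_measurable M" "v \<in> borel_measurable M" and "0 \<le> C"
  shows "wnorm M w v \<le> ennreal C \<longleftrightarrow> (AE y in M. sqrt (w y) * \<bar>v y\<bar> \<le> C)"
proof
  assume "wnorm M w v \<le> ennreal C"
  moreover have "AE y in M. ennreal (sqrt (w y) * \<bar>v y\<bar>) \<le> wnorm M w v"
    unfolding wnorm_def by (rule esssup_AE)
  ultimately have "AE y in M. ennreal (sqrt (w y) * \<bar>v y\<bar>) \<le> ennreal C"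
    by (auto elim!: eventually_mono)
  thus "AE y in M. sqrt (w y) * \<bar>v y\<bar> \<le> C" using \<open>0 \<le> C\<close> by simp
next
  assume "AE y in M. sqrt (w y) * \<bar>v y\<bar> \<le> C"
  hence "AE y in M. ennreal (sqrt (w y) * \<bar>v y\<bar>) \<le> ennreal C"
    by eventually_elim (rule ennreal_leI)
  thus "wnorm M w v \<le> ennreal C" unfolding wnorm_def by (intro esssup_I) simp_all
qed

lemma wnorm_triangle:
  assumes w: "w \<in> borel_measurable M" "AE y in M. 0 \<le> w y"
    and uv: "u \<in> borel_measurable M" "v \<in> borel_measurable M"
  shows "wnorm M w (\<lambda>y. u y + v y) \<le> wnorm M w u + wnorm M w v"
proof (cases "wnorm M w u"; cases "wnorm M w v")
  fix c d assume cd: "wnorm M w u = ennreal c" "0 \<le> c" "wnorm M w v = ennreal d" "0 \<le> d"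
  have "AE y in M. sqrt (w y) * \<bar>u y\<bar> \<le> c" "AE y in M. sqrt (w y) * \<bar>v y\<bar> \<le> d"
    using wnorm_le_iff[OF w(1) uv(1) cd(2)] wnorm_le_iff[OF w(1) uv(2) cd(4)] cd by auto
  with w(2) have "AE y in M. sqrt (w y) * \<bar>u y + v y\<bar> \<le> c + d"
  proof eventually_elim
    case (elim y)
    have "sqrt (w y) * \<bar>u y + v y\<bar> \<le> sqrt (w y) * (\<bar>u y\<bar> + \<bar>v y\<bar>)"
      using elim by (intro mult_left_mono) auto
    with elim show ?case by (simp add: distrib_left)
  qed
  hence "wnorm M w (\<lambda>y. u y + v y) \<le> ennreal (c + d)"
    using w uv cd by (subst wnorm_le_iff) auto
  thus ?thesis using cd by simp
qed auto

lemma wdist_commute: "wdist M w u v = wdist M w v u"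
  by (simp add: wdist_def wnorm_def abs_minus_commute)

lemma wdist_self: "wdist M w u u = 0"
proof -
  have "esssup M (\<lambda>y. 0 :: ennreal) \<le> 0" by (rule esssup_I) auto
  thus ?thesis by (simp add: wdist_def wnorm_def)
qed

lemma wdist_triangle:
  assumes "w \<in> borel_measurable M" "AE y in M. 0 \<le> w y"
    and "u \<in> borel_measurable M" "v \<in> borel_measurable M" "z \<in> borel_measurable M"
  shows "wdist M w u z \<le> wdist M w u v + wdist M w v z"
  using wnorm_triangle[OF assms(1,2), of "\<lambda>y. u y - v y" "\<lambda>y. v y - z y"] assms
  by (simp add: wdist_def fun_diff_def)

lemma wdist_le_iff:
  assumes "w \<in> borel_measurable M" "u \<in> borel_measurable M" "v \<in> borel_measurable M" "0 \<le> C"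
  shows "wdist M w u v \<le> ennreal C \<longleftrightarrow> (AE y in M. sqrt (w y) * \<bar>u y - v y\<bar> \<le> C)"
  using wnorm_le_iff[OF assms(1) _ assms(4), of "u - v"] assms
  by (simp add: wdist_def fun_diff_def)

locale weighted_prob_space = prob_space +
  fixes w :: "'a \<Rightarrow> real"
  assumes w_measurable[measurable]: "w \<in> borel_measurable M"
    and w_nonneg: "y \<in> space M \<Longrightarrow> 0 \<le> w y"
    and w_inverse: "(\<integral>\<^sup>+y. inverse (ennreal (w y)) \<partial>M) = 1"
begin

lemma w_pos: "AE y in M. 0 < w y"
proof -
  have "AE y in M. inverse (ennreal (w y)) \<noteq> \<infinity>"
    by (rule nn_integral_noteq_infinite) (simp_all add: w_inverse)
  thus ?thesis
  proof eventually_elim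
    case (elim y)
    show ?case
    proof (rule ccontr)
      assume "\<not> 0 < w y"
      hence "ennreal (w y) = 0" by (simp add: ennreal_neg)
      thus False using elim by simp
    qed
  qed
qed

lemma w_nonneg_AE: "AE y in M. 0 \<le> w y" "AE y in M. 0 \<le> (w y)\<^sup>2"
  using w_nonneg by auto

text \<open>
  The normalisation of the weight makes the inclusion of the weighted space into \<open>L\<^sup>2\<close> a
  contraction: \<open>\<bar>v\<bar>\<^sup>2 \<le> C\<^sup>2 / w\<close> is integrated.
\<close>

lemma L2_norm_le_wnorm:
  assumes v: "v \<in> L2_space M" and C: "0 \<le> C" "wnorm M w v \<le> ennreal C"
  shows "L2_norm M v \<le> C"
proof -
  note [measurable] = L2_spaceD(1)[OF v]
  have "AE y in M. sqrt (w y) * \<bar>v y\<bar> \<le> C" using wnorm_le_iff[of w M v C] C by simp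
  with w_pos have "AE y in M. ennreal ((v y)\<^sup>2) \<le> ennreal (C\<^sup>2) * inverse (ennreal (w y))"
  proof eventually_elim
    case (elim y)
    have "(sqrt (w y) * \<bar>v y\<bar>)\<^sup>2 \<le> C\<^sup>2" using elim by (intro power_mono) auto
    hence "(v y)\<^sup>2 \<le> C\<^sup>2 * inverse (w y)" using elim by (simp add: power_mult_distrib field_simps)
    hence "ennreal ((v y)\<^sup>2) \<le> ennreal (C\<^sup>2 * inverse (w y))" by (rule ennreal_leI)
    thus ?case using elim by (simp add: ennreal_mult inverse_ennreal)
  qed
  hence "(\<integral>\<^sup>+y. ennreal ((v y)\<^sup>2) \<partial>M) \<le> (\<integral>\<^sup>+y. ennreal (C\<^sup>2) * inverse (ennreal (w y)) \<partial>M)"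
    by (rule nn_integral_mono_AE)
  also have "\<dots> = ennreal (C\<^sup>2)" by (subst nn_integral_cmult) (simp_all add: w_inverse)
  also have "(\<integral>\<^sup>+y. ennreal ((v y)\<^sup>2) \<partial>M) = ennreal ((L2_norm M v)\<^sup>2)"
    unfolding L2_norm_power2 using L2_spaceD(2)[OF v] by (intro nn_integral_eq_integral) auto
  finally have "(L2_norm M v)\<^sup>2 \<le> C\<^sup>2" by simp
  thus ?thesis using C(1) by (rule power2_le_imp_le)
qed

lemma wspace_L2: "wspace M w \<subseteq> L2_space M"
  by (auto simp: wspace_def)

lemma L2_norm_diff_le_wdist:
  assumes "u \<in> L2_space M" "v \<in> L2_space M" "0 \<le> C" "wdist M w u v \<le> ennreal C"
  shows "\<bar>L2_norm M u - L2_norm M v\<bar> \<le> C"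
  using L2_norm_diff_abs[OF assms(1,2)] L2_norm_le_wnorm[OF L2_space_diff[OF assms(1,2)] assms(3)] assms(4)
  by (auto simp: wdist_def fun_diff_def)

lemma topspace_wtopology: "topspace (wtopology M w) = wspace M w"
  unfolding wtopology_def by (rule topspace_pseudometric) (rule wdist_self)

section \<open>Closures\<close>

text \<open>
  Convergence in the weighted norm implies almost everywhere and \<open>L\<^sup>2\<close> convergence, so the bound
  \<open>\<bar>a\<bar>\<^sup>2 \<le> \<parallel>a\<parallel>\<^sup>2 K\<close> survives in the limit.
\<close>

lemma variation_closure:
  assumes A: "A \<subseteq> wspace M w"
  shows "AE y in M. variation M A y = variation M (wtopology M w closure_of A) y"
proof -
  let ?cl = "wtopology M w closure_of A" and ?K = "variation M A"
  have A_L2: "A \<subseteq> L2_space M" and cl_L2: "?cl \<subseteq> L2_space M"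
    using A wspace_L2 closure_of_subset_topspace[of "wtopology M w" A] by (auto simp: topspace_wtopology)
  have "AE y in M. variation M ?cl y \<le> ?K y"
  proof (subst variation_le_iff[OF cl_L2 variation_measurable[OF A_L2]], intro ballI)
    fix u assume u: "u \<in> ?cl"
    hence u_L2: "u \<in> L2_space M" using cl_L2 by blast
    show "AE y in M. ennreal ((u y)\<^sup>2) \<le> ennreal ((L2_norm M u)\<^sup>2) * ?K y"
    proof (cases "0 < L2_norm M u")
      case False
      hence "AE y in M. u y = 0" using L2_norm_pos_iff[OF u_L2] by simp
      thus ?thesis by eventually_elim simp
    next
      case pos: True
      have "\<exists>a\<in>A. wdist M w u a \<le> ennreal (inverse (real (Suc n)))" for n
      proof -
        have "0 < ennreal (inverse (real (Suc n)))" by simp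
        with u obtain a where "a \<in> A" "wdist M w u a < ennreal (inverse (real (Suc n)))"
          unfolding wtopology_def using closure_of_pseudometricD[of "wspace M w" "wdist M w"] wdist_self
          by metis
        thus ?thesis by (auto intro: less_imp_le)
      qed
      then obtain a where a: "\<And>n. a n \<in> A" "\<And>n. wdist M w u (a n) \<le> ennreal (inverse (real (Suc n)))"
        by metis
      have a_L2: "a n \<in> L2_space M" for n using a(1) A_L2 by blast
      have norm_lim: "(\<lambda>n. L2_norm M (a n)) \<longlonglongrightarrow> L2_norm M u"
      proof (rule LIMSEQ_I, goal_cases)
        case (1 e)
        then obtain N where N: "inverse (real (Suc N)) < e" using reals_Archimedean by blast
        have "norm (L2_norm M (a n) - L2_norm M u) < e" if "N \<le> n" for n
        proof -
          have "\<bar>L2_norm M u - L2_norm M (a n)\<bar> \<le> inverse (real (Suc n))"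
            using a(2) by (intro L2_norm_diff_le_wdist u_L2 a_L2) auto
          also have "\<dots> \<le> inverse (real (Suc N))" using that by (intro le_imp_inverse_le) auto
          finally show ?thesis using N by (simp add: abs_minus_commute)
        qed
        thus ?case by blast
      qed
      have "AE y in M. sqrt (w y) * \<bar>u y - a n y\<bar> \<le> inverse (real (Suc n))" for n
        using a(2)[of n] wdist_le_iff[OF w_measurable L2_spaceD(1)[OF u_L2] L2_spaceD(1)[OF a_L2[of n]],
          of "inverse (real (Suc n))"] by simp
      hence "AE y in M. \<forall>n. sqrt (w y) * \<bar>u y - a n y\<bar> \<le> inverse (real (Suc n))"
        by (simp add: AE_all_countable)
      moreover have "AE y in M. \<forall>n. ennreal ((a n y)\<^sup>2) \<le> ennreal ((L2_norm M (a n))\<^sup>2) * ?K y"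
        using square_le_variation[OF A_L2 a(1)] by (simp add: AE_all_countable)
      ultimately show ?thesis using w_pos
      proof eventually_elim
        case (elim y)
        show ?case
        proof (cases "?K y")
          case top
          thus ?thesis using pos by (simp add: ennreal_mult_top)
        next
          case (real k)
          have lim: "(\<lambda>n. a n y) \<longlonglongrightarrow> u y"
          proof (rule LIM_zero_cancel, rule Lim_null_comparison)
            have "\<bar>a n y - u y\<bar> \<le> inverse (real (Suc n)) / sqrt (w y)" for n
              using elim(1)[rule_format, of n] elim(3) by (simp add: pos_le_divide_eq mult.commute abs_minus_commute del: of_nat_Suc)
            thus "\<forall>\<^sub>F n in sequentially. norm (a n y - u y) \<le> inverse (real (Suc n)) / sqrt (w y)"
              by simp
            show "(\<lambda>n. inverse (real (Suc n)) / sqrt (w y)) \<longlonglongrightarrow> 0"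
              using tendsto_divide_zero[OF LIMSEQ_inverse_real_of_nat] .
          qed
          have "(u y)\<^sup>2 \<le> (L2_norm M u)\<^sup>2 * k"
          proof (rule LIMSEQ_le)
            show "(\<lambda>n. (a n y)\<^sup>2) \<longlonglongrightarrow> (u y)\<^sup>2" by (intro tendsto_intros lim)
            show "(\<lambda>n. (L2_norm M (a n))\<^sup>2 * k) \<longlonglongrightarrow> (L2_norm M u)\<^sup>2 * k"
              by (intro tendsto_intros norm_lim)
            have "(a n y)\<^sup>2 \<le> (L2_norm M (a n))\<^sup>2 * k" for n
              using elim(2)[rule_format, of n] real by (simp add: ennreal_mult[symmetric])
            thus "\<exists>N. \<forall>n\<ge>N. (a n y)\<^sup>2 \<le> (L2_norm M (a n))\<^sup>2 * k" by blast
          qed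
          thus ?thesis using real by (simp add: ennreal_mult[symmetric])
        qed
      qed
    qed
  qed
  moreover have "AE y in M. ?K y \<le> variation M ?cl y"
    using A cl_L2 by (intro variation_mono closure_of_subset) (simp_all add: topspace_wtopology)
  ultimately show ?thesis by eventually_elim (rule antisym)
qed

section \<open>Continuity of the variation\<close>

text \<open>
  The least such \<open>R\<close>, squared, is the norm of the variation function for the weight \<open>w\<^sup>2\<close>. Finiteness
  of the variation is therefore the existence of such a bound.
\<close>

definition norm_ratio_bounded :: "real \<Rightarrow> ('a \<Rightarrow> real) set \<Rightarrow> bool" where
  "norm_ratio_bounded R A \<longleftrightarrow> 0 \<le> R \<and> (\<forall>a\<in>normalized M A. wnorm M w a \<le> ennreal R)"

lemma real_variation_measurable:
  "A \<subseteq> L2_space M \<Longrightarrow> real_variation M A \<in> borel_measurable M"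
  unfolding real_variation_def using variation_measurable[of A] by measurable

lemma variation_le_of_normalized:
  assumes A: "A \<subseteq> L2_space M" and t: "t \<in> borel_measurable M"
    and a: "\<And>a. a \<in> normalized M A \<Longrightarrow> AE y in M. (a y)\<^sup>2 \<le> t y"
  shows "AE y in M. variation M A y \<le> ennreal (t y)"
proof -
  have "AE y in M. ennreal (\<bar>a y\<bar>\<^sup>2) \<le> ennreal (t y)" if "a \<in> normalized M A" for a
    using a[OF that] by eventually_elim (simp add: ennreal_leI)
  thus ?thesis using variation_is_ess_Sup[OF A] t by (auto simp: is_ess_Sup_def)
qed

lemma square_normalized_le_variation:
  assumes "A \<subseteq> L2_space M" "a \<in> normalized M A"
  shows "AE y in M. ennreal ((a y)\<^sup>2) \<le> variation M A y"
  using variation_is_ess_Sup[OF assms(1)] assms(2) by (auto simp: is_ess_Sup_def)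

lemma norm_ratio_bounded_AE:
  assumes "A \<subseteq> L2_space M" "norm_ratio_bounded R A" "a \<in> normalized M A"
  shows "AE y in M. sqrt (w y) * \<bar>a y\<bar> \<le> R"
  using assms wnorm_le_iff[of w M a R] L2_spaceD(1)[OF normalized_L2(1)[OF assms(1,3)]]
  by (auto simp: norm_ratio_bounded_def)

lemma norm_ratio_bounded_variation:
  assumes A: "A \<subseteq> L2_space M" and R: "norm_ratio_bounded R A"
  shows "AE y in M. variation M A y \<le> ennreal (R\<^sup>2 / w y)"
proof (rule variation_le_of_normalized[OF A])
  fix a assume "a \<in> normalized M A"
  from norm_ratio_bounded_AE[OF A R this] w_pos
  show "AE y in M. (a y)\<^sup>2 \<le> R\<^sup>2 / w y"
  proof eventually_elim
    case (elim y)
    have "(sqrt (w y) * \<bar>a y\<bar>)\<^sup>2 \<le> R\<^sup>2" using elim by (intro power_mono) auto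
    thus ?case using elim by (simp add: power_mult_distrib field_simps)
  qed
qed simp

lemma has_finite_variation_iff:
  assumes A: "A \<subseteq> L2_space M"
  shows "has_finite_variation M w A \<longleftrightarrow> (\<exists>R. norm_ratio_bounded R A)"
proof
  assume fin: "has_finite_variation M w A"
  hence "wnorm M (\<lambda>y. (w y)\<^sup>2) (real_variation M A) < \<infinity>"
    by (simp add: has_finite_variation_def wspace_measurable_def)
  then obtain C where C: "wnorm M (\<lambda>y. (w y)\<^sup>2) (real_variation M A) = ennreal C" "0 \<le> C"
    by (cases "wnorm M (\<lambda>y. (w y)\<^sup>2) (real_variation M A)") auto
  have wK: "AE y in M. sqrt ((w y)\<^sup>2) * \<bar>real_variation M A y\<bar> \<le> C"
    using C real_variation_measurable[OF A] by (subst wnorm_le_iff[symmetric]) auto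
  have "wnorm M w a \<le> ennreal (sqrt C)" if a: "a \<in> normalized M A" for a
  proof (subst wnorm_le_iff)
    show "a \<in> borel_measurable M" using normalized_L2(1)[OF A a] by (rule L2_spaceD)
    have "AE y in M. variation M A y < \<infinity>" using fin by (simp add: has_finite_variation_def)
    with square_normalized_le_variation[OF A a] w_pos wK
    show "AE y in M. sqrt (w y) * \<bar>a y\<bar> \<le> sqrt C"
    proof eventually_elim
      case (elim y)
      have "(a y)\<^sup>2 \<le> real_variation M A y"
        using enn2real_mono[OF elim(1)] elim(4) by (simp add: real_variation_def)
      hence "w y * (a y)\<^sup>2 \<le> w y * real_variation M A y" using elim(2) by (intro mult_left_mono) auto
      also have "\<dots> \<le> C" using elim(2,3) by (simp add: real_variation_def)
      finally have "sqrt (w y * (a y)\<^sup>2) \<le> sqrt C" by simp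
      thus ?case by (simp add: real_sqrt_mult)
    qed
  qed (use C in auto)
  hence "norm_ratio_bounded (sqrt C) A" using C by (simp add: norm_ratio_bounded_def)
  thus "\<exists>R. norm_ratio_bounded R A" ..
next
  assume "\<exists>R. norm_ratio_bounded R A"
  then obtain R where R: "norm_ratio_bounded R A" by blast
  note K = norm_ratio_bounded_variation[OF A R]
  have "AE y in M. variation M A y < \<infinity>"
    using K by eventually_elim (auto intro: le_less_trans)
  moreover have "AE y in M. sqrt ((w y)\<^sup>2) * \<bar>real_variation M A y\<bar> \<le> R\<^sup>2"
    using K w_pos
  proof eventually_elim
    case (elim y)
    have "real_variation M A y \<le> R\<^sup>2 / w y"
      using elim unfolding real_variation_def by (intro enn2real_leI) auto
    thus ?case using elim by (simp add: real_variation_def field_simps)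
  qed
  hence "wnorm M (\<lambda>y. (w y)\<^sup>2) (real_variation M A) \<le> ennreal (R\<^sup>2)"
    using real_variation_measurable[OF A] by (subst wnorm_le_iff) auto
  hence "wnorm M (\<lambda>y. (w y)\<^sup>2) (real_variation M A) < \<infinity>" by (auto intro: le_less_trans)
  ultimately show "has_finite_variation M w A"
    using real_variation_measurable[OF A] by (simp add: has_finite_variation_def wspace_measurable_def)
qed

text \<open>
  If every unit element of \<open>A\<close> is \<open>\<delta>\<close>-close to one of \<open>B\<close>, then \<open>\<surd>(w K\<^sub>A) \<le> \<surd>(w K\<^sub>B) + \<delta>\<close>, since
  \<open>\<surd>K\<close> is a supremum of absolute values; squaring adds at most \<open>2 \<delta> R + \<delta>\<^sup>2\<close> to \<open>w K\<^sub>B\<close>.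
\<close>

lemma real_variation_perturb:
  assumes A: "A \<subseteq> L2_space M" and B: "B \<subseteq> L2_space M" and R: "norm_ratio_bounded R B"
    and \<delta>: "0 \<le> \<delta>" and close: "\<forall>a\<in>normalized M A. \<exists>b\<in>normalized M B. wdist M w a b \<le> ennreal \<delta>"
  shows "AE y in M. w y * real_variation M A y \<le> w y * real_variation M B y + (2 * \<delta> * R + \<delta>\<^sup>2)"
proof -
  note [measurable] = real_variation_measurable[OF B]
  have R0: "0 \<le> R" using R by (simp add: norm_ratio_bounded_def)
  have finB: "AE y in M. variation M B y < \<infinity>"
    using R has_finite_variation_iff[OF B] by (auto simp: has_finite_variation_def)
  have "AE y in M. variation M A y \<le> ennreal (real_variation M B y + (2 * \<delta> * R + \<delta>\<^sup>2) / w y)"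
  proof (rule variation_le_of_normalized[OF A])
    fix a assume a: "a \<in> normalized M A"
    then obtain b where b: "b \<in> normalized M B" "wdist M w a b \<le> ennreal \<delta>" using close by blast
    have "AE y in M. sqrt (w y) * \<bar>a y - b y\<bar> \<le> \<delta>"
      using b \<delta> a A B wdist_le_iff[of w M a b \<delta>] L2_spaceD(1)[OF normalized_L2(1)[OF A a]]
        L2_spaceD(1)[OF normalized_L2(1)[OF B b(1)]] by auto
    with norm_ratio_bounded_AE[OF B R b(1)] square_normalized_le_variation[OF B b(1)] finB w_pos
    show "AE y in M. (a y)\<^sup>2 \<le> real_variation M B y + (2 * \<delta> * R + \<delta>\<^sup>2) / w y"
    proof eventually_elim
      case (elim y)
      have bK: "(b y)\<^sup>2 \<le> real_variation M B y"
        using enn2real_mono[OF elim(2)] elim(3) by (simp add: real_variation_def)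
      have "sqrt (w y) * \<bar>a y\<bar> \<le> sqrt (w y) * (\<bar>b y\<bar> + \<bar>a y - b y\<bar>)"
        using elim(4) by (intro mult_left_mono) auto
      also have "\<dots> \<le> sqrt (w y) * \<bar>b y\<bar> + \<delta>" using elim(5) by (simp add: distrib_left)
      finally have "(sqrt (w y) * \<bar>a y\<bar>)\<^sup>2 \<le> (sqrt (w y) * \<bar>b y\<bar> + \<delta>)\<^sup>2"
        using elim(4) by (intro power_mono) auto
      also have "\<dots> = w y * (b y)\<^sup>2 + 2 * \<delta> * (sqrt (w y) * \<bar>b y\<bar>) + \<delta>\<^sup>2"
        using elim(4) by (simp add: power2_sum power_mult_distrib)
      also have "\<dots> \<le> w y * real_variation M B y + 2 * \<delta> * R + \<delta>\<^sup>2"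
        using bK elim(1,4) \<delta> by (intro add_mono mult_left_mono) auto
      finally have "w y * (a y)\<^sup>2 \<le> w y * real_variation M B y + (2 * \<delta> * R + \<delta>\<^sup>2)"
        using elim(4) by (simp add: power_mult_distrib)
      thus ?case using elim(4) by (simp add: field_simps)
    qed
  qed simp
  with w_pos show ?thesis
  proof eventually_elim
    case (elim y)
    have "real_variation M A y \<le> real_variation M B y + (2 * \<delta> * R + \<delta>\<^sup>2) / w y"
      unfolding real_variation_def[of M A] using elim R0 \<delta>
      by (intro enn2real_leI) (auto simp: real_variation_def)
    thus ?case using elim by (simp add: field_simps)
  qed
qed

lemma norm_ratio_bounded_perturb:
  assumes A: "A \<subseteq> L2_space M" and B: "B \<subseteq> L2_space M" and R: "norm_ratio_bounded R B"
    and \<delta>: "0 \<le> \<delta>" and close: "\<forall>a\<in>normalized M A. \<exists>b\<in>normalized M B. wdist M w a b \<le> ennreal \<delta>"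
  shows "norm_ratio_bounded (R + \<delta>) A"
proof -
  have "wnorm M w a \<le> ennreal (R + \<delta>)" if a: "a \<in> normalized M A" for a
  proof -
    obtain b where b: "b \<in> normalized M B" "wdist M w a b \<le> ennreal \<delta>" using close a by blast
    note ab = L2_spaceD(1)[OF normalized_L2(1)[OF A a]] L2_spaceD(1)[OF normalized_L2(1)[OF B b(1)]]
    have "wnorm M w a \<le> wdist M w a b + wnorm M w b"
      using wnorm_triangle[OF w_measurable w_nonneg_AE(1), of "\<lambda>y. a y - b y" b] ab
      by (simp add: wdist_def fun_diff_def)
    also have "\<dots> \<le> ennreal \<delta> + ennreal R"
      using b R by (intro add_mono) (auto simp: norm_ratio_bounded_def)
    finally show ?thesis using R \<delta> by (simp add: norm_ratio_bounded_def add.commute)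
  qed
  thus ?thesis using R \<delta> by (simp add: norm_ratio_bounded_def)
qed

lemma wdist_real_variation_le:
  assumes A: "A \<subseteq> L2_space M" and B: "B \<subseteq> L2_space M" and R: "norm_ratio_bounded R A" and \<delta>: "0 \<le> \<delta>"
    and AB: "\<forall>a\<in>normalized M A. \<exists>b\<in>normalized M B. wdist M w a b \<le> ennreal \<delta>"
    and BA: "\<forall>b\<in>normalized M B. \<exists>a\<in>normalized M A. wdist M w a b \<le> ennreal \<delta>"
  shows "has_finite_variation M w B"
    and "wdist M (\<lambda>y. (w y)\<^sup>2) (real_variation M A) (real_variation M B)
      \<le> ennreal (2 * \<delta> * (R + \<delta>) + \<delta>\<^sup>2)"
proof -
  have R0: "0 \<le> R" using R by (simp add: norm_ratio_bounded_def)
  have BA': "\<forall>b\<in>normalized M B. \<exists>a\<in>normalized M A. wdist M w b a \<le> ennreal \<delta>"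
    using BA by (simp add: wdist_commute)
  have RB: "norm_ratio_bounded (R + \<delta>) B" by (rule norm_ratio_bounded_perturb[OF B A R \<delta> BA'])
  thus "has_finite_variation M w B" using has_finite_variation_iff[OF B] by blast
  have mono: "2 * \<delta> * R + \<delta>\<^sup>2 \<le> 2 * \<delta> * (R + \<delta>) + \<delta>\<^sup>2" using \<delta> by (intro add_mono mult_left_mono) auto
  have "AE y in M. sqrt ((w y)\<^sup>2) * \<bar>real_variation M A y - real_variation M B y\<bar>
      \<le> 2 * \<delta> * (R + \<delta>) + \<delta>\<^sup>2"
    using real_variation_perturb[OF A B RB \<delta> AB] real_variation_perturb[OF B A R \<delta> BA'] w_pos
  proof eventually_elim
    case (elim y)
    have "sqrt ((w y)\<^sup>2) * \<bar>real_variation M A y - real_variation M B y\<bar>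
        = \<bar>w y * real_variation M A y - w y * real_variation M B y\<bar>"
      using elim(3) by (simp add: abs_mult right_diff_distrib[symmetric])
    thus ?case using elim mono by linarith
  qed
  thus "wdist M (\<lambda>y. (w y)\<^sup>2) (real_variation M A) (real_variation M B)
      \<le> ennreal (2 * \<delta> * (R + \<delta>) + \<delta>\<^sup>2)"
    using real_variation_measurable[OF A] real_variation_measurable[OF B] R0 \<delta>
    by (subst wdist_le_iff) auto
qed

end

text \<open>The expression is the modulus of continuity of \<open>wdist_real_variation_le\<close>.\<close>

lemma ex_real_modulus:
  fixes e :: ennreal and R :: real
  assumes "0 < e" "0 \<le> R"
  obtains \<delta> where "0 < \<delta>" "ennreal (2 * \<delta> * (R + \<delta>) + \<delta>\<^sup>2) < e"
proof -
  obtain c where c: "0 < c" "ennreal c \<le> e"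
  proof (cases e)
    case (real r)
    thus ?thesis using that[of r] \<open>0 < e\<close> by simp
  next
    case top
    thus ?thesis using that[of 1] by simp
  qed
  \<comment> \<open>for \<open>\<delta> \<le> 1\<close> the expression is at most \<open>\<delta> (2 R + 3)\<close>\<close>
  define \<delta> where "\<delta> = min 1 (c / (2 * R + 4))"
  have \<delta>: "0 < \<delta>" "\<delta> \<le> 1" "\<delta> \<le> c / (2 * R + 4)"
    using c assms(2) by (simp_all add: \<delta>_def)
  have "2 * \<delta> * (R + \<delta>) + \<delta>\<^sup>2 \<le> 2 * \<delta> * (R + 1) + \<delta> * 1"
    unfolding power2_eq_square using \<delta> by (intro add_mono mult_left_mono) auto
  also have "\<dots> < \<delta> * (2 * R + 4)" using \<delta> by (simp add: algebra_simps)
  also have "\<dots> \<le> c" using \<delta>(3) assms(2) by (subst (asm) pos_le_divide_eq) auto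
  finally have "ennreal (2 * \<delta> * (R + \<delta>) + \<delta>\<^sup>2) < ennreal c" using c by (simp add: ennreal_lessI)
  thus ?thesis using \<delta>(1) c(2) that by (meson less_le_trans)
qed

context weighted_prob_space
begin

text \<open>
  A bound for the Hausdorff distance of the sets of unit elements that exhibits the nearby elements.
\<close>

definition normalized_close :: "real \<Rightarrow> ('a \<Rightarrow> real) set \<Rightarrow> ('a \<Rightarrow> real) set \<Rightarrow> bool" where
  "normalized_close \<delta> A B \<longleftrightarrow>
    (\<forall>a\<in>normalized M A. \<exists>b\<in>normalized M B. wdist M w a b \<le> ennreal \<delta>) \<and>
    (\<forall>b\<in>normalized M B. \<exists>a\<in>normalized M A. wdist M w a b \<le> ennreal \<delta>)"

definition variation_close :: "ennreal \<Rightarrow> ('a \<Rightarrow> real) set \<Rightarrow> ('a \<Rightarrow> real) set \<Rightarrow> bool" where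
  "variation_close e A B \<longleftrightarrow> has_finite_variation M w B \<and>
    wdist M (\<lambda>y. (w y)\<^sup>2) (real_variation M A) (real_variation M B) < e"

lemma variation_continuous_at:
  assumes A: "A \<subseteq> L2_space M" and fin: "has_finite_variation M w A" and "0 < e"
  shows "\<exists>\<delta>>0. \<forall>B. B \<subseteq> L2_space M \<longrightarrow> normalized_close \<delta> A B \<longrightarrow> variation_close e A B"
proof -
  obtain R where R: "norm_ratio_bounded R A" using fin has_finite_variation_iff[OF A] by blast
  hence "0 \<le> R" by (simp add: norm_ratio_bounded_def)
  then obtain \<delta> where \<delta>: "0 < \<delta>" "ennreal (2 * \<delta> * (R + \<delta>) + \<delta>\<^sup>2) < e"
    by (rule ex_real_modulus[OF \<open>0 < e\<close>])
  have "variation_close e A B" if "B \<subseteq> L2_space M" "normalized_close \<delta> A B" for B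
    using wdist_real_variation_le[OF A that(1) R less_imp_le[OF \<delta>(1)]] \<delta>(2) that(2)
    unfolding variation_close_def normalized_close_def by (blast intro: le_less_trans)
  with \<delta>(1) show ?thesis by blast
qed

text \<open>
  Normalisation is Lipschitz away from the origin, through
  \<open>u / \<parallel>u\<parallel> - v / \<parallel>v\<parallel> = (u - v) / \<parallel>v\<parallel> + (u / \<parallel>u\<parallel>) (\<parallel>v\<parallel> - \<parallel>u\<parallel>) / \<parallel>v\<parallel>\<close>. Splitting off the unit element
  built from \<open>u\<close> makes the constant depend on \<open>v\<close> only through the lower bound for its norm.
\<close>

lemma wdist_normalized_le:
  assumes u: "u \<in> L2_space M" and v: "v \<in> L2_space M" and r: "0 < r" "r \<le> L2_norm M u" "r \<le> L2_norm M v"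
    and R: "0 \<le> R" "wnorm M w (\<lambda>y. u y / L2_norm M u) \<le> ennreal R"
    and \<delta>: "0 \<le> \<delta>" "wdist M w u v \<le> ennreal \<delta>"
  shows "wdist M w (\<lambda>y. u y / L2_norm M u) (\<lambda>y. v y / L2_norm M v) \<le> ennreal (\<delta> * (1 + R) / r)"
proof -
  note [measurable] = L2_spaceD(1)[OF u] L2_spaceD(1)[OF v]
  let ?U = "L2_norm M u" and ?V = "L2_norm M v"
  have UV: "\<bar>?U - ?V\<bar> \<le> \<delta>" by (rule L2_norm_diff_le_wdist[OF u v \<delta>])
  have "AE y in M. sqrt (w y) * \<bar>u y - v y\<bar> \<le> \<delta>"
    using \<delta> by (subst wdist_le_iff[symmetric]) simp_all
  moreover have "AE y in M. sqrt (w y) * \<bar>u y / ?U\<bar> \<le> R"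
    using R by (subst wnorm_le_iff[symmetric]) simp_all
  ultimately have "AE y in M. sqrt (w y) * \<bar>u y / ?U - v y / ?V\<bar> \<le> \<delta> * (1 + R) / r"
    using w_pos
  proof eventually_elim
    case (elim y)
    have pos: "0 < ?U" "0 < ?V" using r by auto
    have "u y / ?U - v y / ?V = (u y - v y) / ?V + u y / ?U * ((?V - ?U) / ?V)"
      using pos by (simp add: field_simps)
    hence "\<bar>u y / ?U - v y / ?V\<bar> \<le> \<bar>(u y - v y) / ?V\<bar> + \<bar>u y / ?U * ((?V - ?U) / ?V)\<bar>"
      using abs_triangle_ineq by metis
    also have "\<dots> = (\<bar>u y - v y\<bar> + \<bar>u y / ?U\<bar> * \<bar>?U - ?V\<bar>) / ?V"
      using pos by (simp add: abs_mult add_divide_distrib abs_minus_commute)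
    finally have "sqrt (w y) * \<bar>u y / ?U - v y / ?V\<bar> \<le>
        sqrt (w y) * ((\<bar>u y - v y\<bar> + \<bar>u y / ?U\<bar> * \<bar>?U - ?V\<bar>) / ?V)"
      using elim(3) by (intro mult_left_mono) auto
    also have "\<dots> = (sqrt (w y) * \<bar>u y - v y\<bar> + (sqrt (w y) * \<bar>u y / ?U\<bar>) * \<bar>?U - ?V\<bar>) / ?V"
      by (simp add: distrib_left mult.assoc)
    also have "\<dots> \<le> (\<delta> + R * \<delta>) / r"
      using elim UV R(1) \<delta>(1) r by (intro frac_le add_mono mult_mono) auto
    finally show ?case by (simp add: algebra_simps)
  qed
  thus ?thesis using r R \<delta> by (subst wdist_le_iff) auto
qed

text \<open>
  Finiteness at \<open>A\<close> propagates to nearby sets because the Lipschitz constant of the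
  normalisation involves the bound \<open>R\<close> for the unit elements of \<open>A\<close> alone, in both directions of
  the Hausdorff distance.
\<close>

lemma variation_hausdorff_continuous_at:
  assumes A: "A \<subseteq> wspace M w" and r: "0 < r" "\<And>u. u \<in> A \<Longrightarrow> r \<le> L2_norm M u"
    and fin: "has_finite_variation M w A" and "0 < e"
  shows "\<exists>\<delta>>0. \<forall>B. B \<subseteq> wspace M w \<longrightarrow> (\<forall>v\<in>B. r \<le> L2_norm M v) \<longrightarrow>
    hausdorff_dist (wdist M w) A B < ennreal \<delta> \<longrightarrow> variation_close e A B"
proof -
  have A_L2: "A \<subseteq> L2_space M" using A wspace_L2 by blast
  obtain \<eta> where \<eta>: "0 < \<eta>"
    "\<And>B. B \<subseteq> L2_space M \<Longrightarrow> normalized_close \<eta> A B \<Longrightarrow> variation_close e A B"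
    using variation_continuous_at[OF A_L2 fin \<open>0 < e\<close>] by blast
  obtain R where R: "norm_ratio_bounded R A" using fin has_finite_variation_iff[OF A_L2] by blast
  have R0: "0 \<le> R" using R by (simp add: norm_ratio_bounded_def)
  \<comment> \<open>the normalisation multiplies distances by at most \<open>(1 + R) / r\<close>\<close>
  define \<delta> where "\<delta> = \<eta> * r / (1 + R)"
  have \<delta>: "0 < \<delta>" "\<delta> * (1 + R) / r = \<eta>" using \<eta>(1) r(1) R0 by (auto simp: \<delta>_def)
  have "variation_close e A B" if B: "B \<subseteq> wspace M w" "\<And>v. v \<in> B \<Longrightarrow> r \<le> L2_norm M v"
    and H: "hausdorff_dist (wdist M w) A B < ennreal \<delta>" for B
  proof -
    have B_L2: "B \<subseteq> L2_space M" using B wspace_L2 by blast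
    have nA: "normalized M A = (\<lambda>u y. u y / L2_norm M u) ` A"
      using A_L2 r L2_norm_pos_iff unfolding normalized_image by (intro arg_cong2[of _ _ _ _ image]) force+
    have nB: "normalized M B = (\<lambda>u y. u y / L2_norm M u) ` B"
      using B_L2 B(2) r(1) L2_norm_pos_iff unfolding normalized_image
      by (intro arg_cong2[of _ _ _ _ image]) force+
    have close: "wdist M w (\<lambda>y. u y / L2_norm M u) (\<lambda>y. v y / L2_norm M v) \<le> ennreal \<eta>"
      if "u \<in> A" "v \<in> B" "wdist M w u v < ennreal \<delta>" for u v
    proof -
      have "wnorm M w (\<lambda>y. u y / L2_norm M u) \<le> ennreal R"
        using R that(1) nA by (simp add: norm_ratio_bounded_def)
      thus ?thesis
        using wdist_normalized_le[of u v r R \<delta>] that A_L2 B_L2 r B(2) R0 \<delta> by (auto simp: less_imp_le)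
    qed
    have "normalized_close \<eta> A B"
      unfolding normalized_close_def
    proof (intro conjI ballI)
      fix a assume "a \<in> normalized M A"
      then obtain u where u: "u \<in> A" "a = (\<lambda>y. u y / L2_norm M u)" unfolding nA by blast
      with hausdorff_dist_lessD(1)[OF H] obtain v where v: "v \<in> B" "wdist M w u v < ennreal \<delta>" by blast
      show "\<exists>b\<in>normalized M B. wdist M w a b \<le> ennreal \<eta>"
        unfolding nB u(2) using close[OF u(1) v] by (intro bexI[OF _ imageI[OF v(1)]])
    next
      fix b assume "b \<in> normalized M B"
      then obtain v where v: "v \<in> B" "b = (\<lambda>y. v y / L2_norm M v)" unfolding nB by blast
      with hausdorff_dist_lessD(2)[OF H] obtain u where u: "u \<in> A" "wdist M w u v < ennreal \<delta>" by blast
      show "\<exists>a\<in>normalized M A. wdist M w a b \<le> ennreal \<eta>"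
        unfolding nA v(2) using close[OF u(1) v(1) u(2)] by (intro bexI[OF _ imageI[OF u(1)]])
    qed
    thus ?thesis by (rule \<eta>(2)[OF B_L2])
  qed
  with \<delta>(1) show ?thesis by (intro exI[of _ \<delta>]) simp
qed

lemma real_variation_in_wspace:
  "has_finite_variation M w A \<Longrightarrow> real_variation M A \<in> wspace_measurable M (\<lambda>y. (w y)\<^sup>2)"
  by (simp add: has_finite_variation_def)

lemma real_variation_continuousI:
  assumes refl: "\<And>A. A \<in> D \<Longrightarrow> d A A = 0"
    and cont: "\<And>A e. A \<in> D \<Longrightarrow> has_finite_variation M w A \<Longrightarrow> 0 < e \<Longrightarrow>
      \<exists>\<delta>>0. \<forall>B\<in>D. d A B < \<delta> \<longrightarrow> variation_close e A B"
  shows "variation_continuous_on M w D d"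
proof -
  let ?F = "{A \<in> D. has_finite_variation M w A}"
  note pc = pseudometric_open_and_continuous[where S = D and d = d and F = ?F and f = "real_variation M"
      and S' = "wspace_measurable M (\<lambda>y. (w y)\<^sup>2)" and d' = "wdist M (\<lambda>y. (w y)\<^sup>2)"]
  have tri: "wdist M (\<lambda>y. (w y)\<^sup>2) x z \<le> wdist M (\<lambda>y. (w y)\<^sup>2) x y + wdist M (\<lambda>y. (w y)\<^sup>2) y z"
    if "x \<in> wspace_measurable M (\<lambda>y. (w y)\<^sup>2)" "y \<in> wspace_measurable M (\<lambda>y. (w y)\<^sup>2)"
      "z \<in> wspace_measurable M (\<lambda>y. (w y)\<^sup>2)" for x y z
    using that w_nonneg_AE(2) by (intro wdist_triangle) (auto simp: wspace_measurable_def)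
  have c: "\<exists>\<delta>>0. \<forall>B\<in>D. d A B < \<delta> \<longrightarrow> B \<in> ?F \<and>
      wdist M (\<lambda>y. (w y)\<^sup>2) (real_variation M A) (real_variation M B) < e"
    if "A \<in> ?F" "0 < e" for A e
    using cont[of A e] that by (fastforce simp: variation_close_def)
  show ?thesis
    unfolding variation_continuous_on_def wtopology_measurable_def
    using pc[OF refl _ wdist_self tri _ c] by (auto dest: real_variation_in_wspace)
qed

lemma variation_continuous_away_from_0:
  assumes "0 < r"
  shows "variation_continuous_on M w (Pow (wspace M w - open_ball0 M r)) (hausdorff_dist (wdist M w))"
proof (rule real_variation_continuousI)
  show "hausdorff_dist (wdist M w) A A = 0" for A by (intro hausdorff_dist_self wdist_self)
  let ?D = "Pow (wspace M w - open_ball0 M r)"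
  have D: "B \<subseteq> wspace M w" "v \<in> B \<Longrightarrow> r \<le> L2_norm M v" if "B \<in> ?D" for B v
    using that wspace_L2 by (force simp: open_ball0_def)+
  fix A and e :: ennreal assume A: "A \<in> ?D" "has_finite_variation M w A" "0 < e"
  have "\<exists>\<delta>>0. \<forall>B. B \<subseteq> wspace M w \<longrightarrow> (\<forall>v\<in>B. r \<le> L2_norm M v) \<longrightarrow>
      hausdorff_dist (wdist M w) A B < ennreal \<delta> \<longrightarrow> variation_close e A B"
    using D(1)[OF A(1)] assms D(2)[OF A(1)] A(2,3) by (rule variation_hausdorff_continuous_at)
  then obtain \<delta> :: real where "0 < \<delta>" "\<forall>B. B \<subseteq> wspace M w \<longrightarrow> (\<forall>v\<in>B. r \<le> L2_norm M v) \<longrightarrow>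
      hausdorff_dist (wdist M w) A B < ennreal \<delta> \<longrightarrow> variation_close e A B"
    by blast
  thus "\<exists>\<delta>>0. \<forall>B\<in>?D. hausdorff_dist (wdist M w) A B < \<delta> \<longrightarrow> variation_close e A B"
    using D by (intro exI[of _ "ennreal \<delta>"]) auto
qed

lemma Cone_subset_L2:
  assumes "X \<subseteq> wspace M w" shows "Cone X \<subseteq> L2_space M"
  using assms wspace_L2 by (auto simp: Cone_def fscale_def intro!: L2_space_scale)

text \<open>On cones the truncation to the unit sphere is the normalisation.\<close>

lemma normalized_Cone:
  assumes "X \<subseteq> wspace M w"
  shows "normalized M (Cone X) = unit_sphere M \<inter> Cone X"
proof (intro equalityI subsetI)
  fix a assume a: "a \<in> normalized M (Cone X)"
  then obtain u where u: "u \<in> Cone X" "\<not> (AE y in M. u y = 0)" "a = (\<lambda>y. u y / L2_norm M u)"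
    by (auto simp: normalized_def)
  then obtain c x where x: "0 < c" "x \<in> X" "u = fscale c x" by (auto simp: Cone_def)
  have "0 < L2_norm M u" using L2_norm_pos_iff[of u M] u Cone_subset_L2[OF assms] by auto
  moreover have "a = fscale (c / L2_norm M u) x"
  proof -
    have "u y = c * x y" for y using x(3) by (simp add: fscale_def)
    thus ?thesis by (simp add: u(3) fscale_def fun_eq_iff)
  qed
  ultimately have "a \<in> Cone X"
    using x(1,2) unfolding Cone_def by (intro CollectI exI[of _ "c / L2_norm M u"] exI[of _ x]) simp
  thus "a \<in> unit_sphere M \<inter> Cone X"
    using normalized_L2[OF Cone_subset_L2[OF assms] a] by (simp add: unit_sphere_def)
next
  fix a assume a: "a \<in> unit_sphere M \<inter> Cone X"
  hence "L2_norm M a = 1" "\<not> (AE y in M. a y = 0)"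
    using L2_norm_pos_iff[of a M] by (auto simp: unit_sphere_def)
  thus "a \<in> normalized M (Cone X)" using a by (auto simp: normalized_def intro!: exI[of _ a])
qed

lemma variation_continuous_on_cones:
  "variation_continuous_on M w (Cone ` Pow (wspace M w)) (truncated_hausdorff_dist M w)"
proof (rule real_variation_continuousI)
  show "truncated_hausdorff_dist M w A A = 0" for A
    unfolding truncated_hausdorff_dist_def by (intro hausdorff_dist_self wdist_self)
  let ?D = "Cone ` Pow (wspace M w)"
  have D: "B \<subseteq> L2_space M" "normalized M B = unit_sphere M \<inter> B" if "B \<in> ?D" for B
    using that Cone_subset_L2 normalized_Cone by blast+
  fix A and e :: ennreal assume A: "A \<in> ?D" "has_finite_variation M w A" "0 < e"
  obtain \<delta> where \<delta>: "0 < \<delta>"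
    "\<And>B. B \<subseteq> L2_space M \<Longrightarrow> normalized_close \<delta> A B \<Longrightarrow> variation_close e A B"
    using variation_continuous_at[OF D(1)[OF A(1)] A(2,3)] by blast
  have "variation_close e A B"
    if B: "B \<in> ?D" and H: "truncated_hausdorff_dist M w A B < ennreal \<delta>" for B
  proof (rule \<delta>(2)[OF D(1)[OF B]])
    note H' = H[unfolded truncated_hausdorff_dist_def D(2)[OF A(1), symmetric] D(2)[OF B, symmetric]]
    show "normalized_close \<delta> A B"
      unfolding normalized_close_def
    proof (intro conjI ballI)
      fix a assume "a \<in> normalized M A"
      from hausdorff_dist_lessD(1)[OF H' this]
      show "\<exists>b\<in>normalized M B. wdist M w a b \<le> ennreal \<delta>" by (auto intro: less_imp_le)
    next
      fix b assume "b \<in> normalized M B"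
      from hausdorff_dist_lessD(2)[OF H' this]
      show "\<exists>a\<in>normalized M A. wdist M w a b \<le> ennreal \<delta>" by (auto intro: less_imp_le)
    qed
  qed
  thus "\<exists>\<delta>>0. \<forall>B\<in>?D. truncated_hausdorff_dist M w A B < \<delta> \<longrightarrow> variation_close e A B"
    using \<delta>(1) by (intro exI[of _ "ennreal \<delta>"]) auto
qed

section \<open>Compact sets\<close>

lemma wspace_obtain_bound:
  assumes "u \<in> wspace M w"
  obtains C where "0 \<le> C" "wnorm M w u = ennreal C"
  using assms by (cases "wnorm M w u") (auto simp: wspace_def)

text \<open>
  Around a nonzero \<open>u\<close>, the ball of radius \<open>\<parallel>u\<parallel> / 2\<close> stays away from the origin in \<open>L\<^sup>2\<close> and is
  bounded in the weighted norm; finitely many of these balls cover a compact set.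
\<close>

lemma nonempty_compacts_bounds:
  assumes X: "X \<in> nonempty_compacts M w"
  shows "\<exists>r>0. \<exists>C\<ge>0. \<forall>v\<in>X. r \<le> L2_norm M v \<and> wnorm M w v \<le> ennreal C"
proof -
  have cpt: "compactin (wtopology M w) X" and nz: "X \<subseteq> L2_nonzero M" and "X \<noteq> {}"
    using X by (auto simp: nonempty_compacts_def compactin_subtopology)
  have XW: "X \<subseteq> wspace M w" using compactin_subset_topspace[OF cpt] by (simp add: topspace_wtopology)
  define ball where "ball u = {v \<in> wspace M w. wdist M w u v < ennreal (L2_norm M u / 2)}" for u
  have pos: "0 < L2_norm M u" if "u \<in> X" for u
    using nz that L2_norm_pos_iff by (auto simp: L2_nonzero_def)
  have "openin (wtopology M w) (ball u)" if "u \<in> X" for u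
    unfolding ball_def wtopology_def using that XW pos[OF that] by (intro openin_pseudometric_ball) auto
  moreover have "X \<subseteq> (\<Union>u\<in>X. ball u)" using XW pos by (auto simp: ball_def wdist_self)
  ultimately obtain \<F> where "finite \<F>" "\<F> \<subseteq> ball ` X" "X \<subseteq> \<Union>\<F>"
    using compactinD[OF cpt, of "ball ` X"] by blast
  then obtain Y where Y: "finite Y" "Y \<subseteq> X" "X \<subseteq> (\<Union>u\<in>Y. ball u)"
    by (metis finite_subset_image)
  have "Y \<noteq> {}" using Y(3) \<open>X \<noteq> {}\<close> by auto
  define r where "r = Min ((\<lambda>u. L2_norm M u / 2) ` Y)"
  define C where "C = Max ((\<lambda>u. enn2real (wnorm M w u) + L2_norm M u / 2) ` Y)"
  have r: "0 < r" using Y \<open>Y \<noteq> {}\<close> pos by (auto simp: r_def)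
  have b: "r \<le> L2_norm M v" "wnorm M w v \<le> ennreal C" if v: "v \<in> X" for v
  proof -
    obtain u where u: "u \<in> Y" "v \<in> ball u" using Y(3) v by blast
    have uv: "u \<in> wspace M w" "v \<in> wspace M w" using u Y XW v by auto
    hence L2: "u \<in> L2_space M" "v \<in> L2_space M" using wspace_L2 by auto
    have d: "wdist M w u v \<le> ennreal (L2_norm M u / 2)" using u by (auto simp: ball_def intro: less_imp_le)
    have "\<bar>L2_norm M u - L2_norm M v\<bar> \<le> L2_norm M u / 2"
      using L2_norm_nonneg[of M u] by (intro L2_norm_diff_le_wdist L2 d) simp
    moreover have "r \<le> L2_norm M u / 2" unfolding r_def using u(1) Y(1) by (intro Min_le) auto
    ultimately show "r \<le> L2_norm M v" by linarith
    obtain c where c: "0 \<le> c" "wnorm M w u = ennreal c" using wspace_obtain_bound[OF uv(1)] by blast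
    have "wnorm M w v \<le> wdist M w v u + wnorm M w u"
      using wnorm_triangle[OF w_measurable w_nonneg_AE(1), of "\<lambda>y. v y - u y" u]
        L2_spaceD(1)[OF L2(1)] L2_spaceD(1)[OF L2(2)]
      by (simp add: wdist_def fun_diff_def)
    also have "\<dots> \<le> ennreal (L2_norm M u / 2) + ennreal c"
      using d c by (intro add_mono) (simp_all add: wdist_commute)
    also have "\<dots> = ennreal (enn2real (wnorm M w u) + L2_norm M u / 2)"
      using c L2_norm_nonneg[of M u] by (simp add: add.commute)
    also have "\<dots> \<le> ennreal C" unfolding C_def using u Y by (intro ennreal_leI Max_ge) auto
    finally show "wnorm M w v \<le> ennreal C" .
  qed
  have "r \<le> L2_norm M v \<and> wnorm M w v \<le> ennreal (max 0 C)" if "v \<in> X" for v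
    using b[OF that] by (auto intro: order_trans ennreal_leI)
  moreover have "0 \<le> max 0 C" by simp
  ultimately show ?thesis using r by meson
qed

lemma nonempty_compacts_subset: "X \<in> nonempty_compacts M w \<Longrightarrow> X \<subseteq> wspace M w"
  using compactin_subset_topspace[of "wtopology M w" X]
  by (auto simp: nonempty_compacts_def compactin_subtopology topspace_wtopology)

lemma nonempty_compacts_has_finite_variation:
  assumes X: "X \<in> nonempty_compacts M w"
  shows "has_finite_variation M w X"
proof -
  obtain r C where rC: "0 < r" "0 \<le> C" "\<And>v. v \<in> X \<Longrightarrow> r \<le> L2_norm M v"
    "\<And>v. v \<in> X \<Longrightarrow> wnorm M w v \<le> ennreal C"
    using nonempty_compacts_bounds[OF X] by blast
  have X_L2: "X \<subseteq> L2_space M" using nonempty_compacts_subset[OF X] wspace_L2 by blast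
  have "wnorm M w a \<le> ennreal (C / r)" if "a \<in> normalized M X" for a
  proof -
    obtain u where u: "u \<in> X" "a = (\<lambda>y. u y / L2_norm M u)" using \<open>a \<in> _\<close> by (auto simp: normalized_def)
    have [measurable]: "u \<in> borel_measurable M" using X_L2 u by (auto simp: L2_space_def)
    have "AE y in M. sqrt (w y) * \<bar>u y\<bar> \<le> C" using rC u by (subst wnorm_le_iff[symmetric]) auto
    hence "AE y in M. sqrt (w y) * \<bar>a y\<bar> \<le> C / r"
    proof eventually_elim
      case (elim y)
      have "(sqrt (w y) * \<bar>u y\<bar>) / L2_norm M u \<le> C / r"
        using elim rC u(1) by (intro frac_le) auto
      thus ?case using rC(1) rC(3)[OF u(1)] by (simp add: u(2) abs_divide)
    qed
    thus ?thesis using rC u by (subst wnorm_le_iff) auto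
  qed
  hence "norm_ratio_bounded (C / r) X" using rC by (simp add: norm_ratio_bounded_def)
  thus ?thesis using has_finite_variation_iff[OF X_L2] by blast
qed

lemma variation_continuous_on_compacts:
  "variation_continuous_on M w (nonempty_compacts M w) (hausdorff_dist (wdist M w))"
proof (rule real_variation_continuousI)
  show "hausdorff_dist (wdist M w) A A = 0" for A by (intro hausdorff_dist_self wdist_self)
  let ?D = "nonempty_compacts M w"
  fix A and e :: ennreal assume A: "A \<in> ?D" "has_finite_variation M w A" "0 < e"
  obtain r where r: "0 < r" "\<And>v. v \<in> A \<Longrightarrow> r \<le> L2_norm M v"
    using nonempty_compacts_bounds[OF A(1)] by blast
  have AW: "A \<subseteq> wspace M w" by (rule nonempty_compacts_subset[OF A(1)])
  have "0 < r / 2" "\<And>u. u \<in> A \<Longrightarrow> r / 2 \<le> L2_norm M u" using r by force+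
  from variation_hausdorff_continuous_at[OF AW this A(2,3)]
  obtain \<delta> :: real where \<delta>: "0 < \<delta>"
    "\<And>B. B \<subseteq> wspace M w \<Longrightarrow> \<forall>v\<in>B. r / 2 \<le> L2_norm M v \<Longrightarrow>
      hausdorff_dist (wdist M w) A B < ennreal \<delta> \<Longrightarrow> variation_close e A B"
    by blast
  have "variation_close e A B"
    if B: "B \<in> ?D" and H: "hausdorff_dist (wdist M w) A B < ennreal (min \<delta> (r / 2))" for B
  proof (rule \<delta>(2))
    show BW: "B \<subseteq> wspace M w" by (rule nonempty_compacts_subset[OF B])
    show "hausdorff_dist (wdist M w) A B < ennreal \<delta>"
      by (rule less_le_trans[OF H]) (simp add: ennreal_leI)
    \<comment> \<open>the members of \<open>B\<close> are within \<open>r / 2\<close> of elements of \<open>A\<close>, whose norms are at least \<open>r\<close>\<close>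
    show "\<forall>v\<in>B. r / 2 \<le> L2_norm M v"
    proof
      fix v assume v: "v \<in> B"
      obtain u where u: "u \<in> A" "wdist M w u v < ennreal (min \<delta> (r / 2))"
        using hausdorff_dist_lessD(2)[OF H v] by blast
      have "wdist M w u v \<le> ennreal (r / 2)"
        by (rule order_trans[OF less_imp_le[OF u(2)]]) (simp add: ennreal_leI)
      hence "\<bar>L2_norm M u - L2_norm M v\<bar> \<le> r / 2"
        using u v AW BW wspace_L2 r(1) by (intro L2_norm_diff_le_wdist) auto
      thus "r / 2 \<le> L2_norm M v" using r(2)[OF u(1)] by linarith
    qed
  qed
  thus "\<exists>\<delta>>0. \<forall>B\<in>?D. hausdorff_dist (wdist M w) A B < \<delta> \<longrightarrow> variation_close e A B"
    using \<delta>(1) r(1) by (intro exI[of _ "ennreal (min \<delta> (r / 2))"]) auto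
qed

lemma real_variation_continuous_on_compacts:
  "continuous_map (pseudometric_topology (nonempty_compacts M w) (hausdorff_dist (wdist M w)))
    (wtopology_measurable M (\<lambda>y. (w y)\<^sup>2)) (real_variation M)"
proof -
  let ?D = "nonempty_compacts M w"
  have "{A \<in> ?D. has_finite_variation M w A} = ?D"
    using nonempty_compacts_has_finite_variation by blast
  moreover have "topspace (pseudometric_topology ?D (hausdorff_dist (wdist M w))) = ?D"
    by (intro topspace_pseudometric hausdorff_dist_self wdist_self)
  ultimately show ?thesis
    using variation_continuous_on_compacts unfolding variation_continuous_on_def
    by (metis subtopology_topspace)
qed

end

section \<open>The properties of the variation function\<close>

theorem theorem2p6:
  fixes M :: "'y measure" and w :: "'y \<Rightarrow> real"
    and A B :: "('y \<Rightarrow> real) set" and \<A> :: "('y \<Rightarrow> real) set set"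
  assumes "prob_space M"
    and "w \<in> borel_measurable M"
    and "\<forall>y\<in>space M. 0 \<le> w y"
    and "(\<integral>\<^sup>+y. inverse (ennreal (w y)) \<partial>M) = 1"
    and "A \<subseteq> wspace M w" and "B \<subseteq> wspace M w" and "\<A> \<subseteq> Pow (wspace M w)"
  shows
    "(AE y in M. variation M (\<Union>\<A>) y = ess_Sup M (variation M ` \<A>) y)
   \<and> (AE y in M. variation M A y = variation M (wtopology M w closure_of A) y)
   \<and> ((\<forall>X\<in>nonempty_compacts M w. has_finite_variation M w X) \<and>
      continuous_map
        (pseudometric_topology (nonempty_compacts M w) (hausdorff_dist (wdist M w)))
        (wtopology_measurable M (\<lambda>y. (w y)\<^sup>2)) (real_variation M))
   \<and> (\<forall>r>0. variation_continuous_on M w (Pow (wspace M w - open_ball0 M r))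
              (hausdorff_dist (wdist M w)))
   \<and> variation_continuous_on M w (Cone ` Pow (wspace M w)) (truncated_hausdorff_dist M w)
   \<and> (orthogonal_sets M A B \<longrightarrow>
        (AE y in M. variation M (A + B) y \<le> variation M A y + variation M B y))
   \<and> (orthogonal_sets M A B \<and> homogeneous A \<and> homogeneous B \<longrightarrow>
        (AE y in M. variation M (A + B) y = variation M A y + variation M B y))
   \<and> (independent_sets M A B \<longrightarrow>
        (AE y in M. variation M (A * B) y = variation M A y * variation M B y))
   \<and> ((AE z in M \<Otimes>\<^sub>M M. variation (M \<Otimes>\<^sub>M M) (elementary_tensors A B) z
          = variation M A (fst z) * variation M B (snd z)) \<and>
      (fun_space.subspace A \<and> fun_space.subspace B \<longrightarrow>
        (AE z in M \<Otimes>\<^sub>M M. variation (M \<Otimes>\<^sub>M M) (tensor_product A B) z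
          = variation M A (fst z) * variation M B (snd z))))"
proof -
  interpret weighted_prob_space M w
    using assms(1-4) by (intro weighted_prob_space.intro weighted_prob_space_axioms.intro) auto
  have L2: "A \<subseteq> L2_space M" "B \<subseteq> L2_space M" "\<A> \<subseteq> Pow (L2_space M)"
    using assms(5-7) wspace_L2 by blast+
  have "AE y in M. variation M (A + B) y = variation M A y + variation M B y"
    if "orthogonal_sets M A B \<and> homogeneous A \<and> homogeneous B"
  proof -
    have "AE y in M. variation M (A + B) y \<le> variation M A y + variation M B y"
      "AE y in M. variation M A y + variation M B y \<le> variation M (A + B) y"
      using variation_add_le[OF L2(1,2)] variation_add_ge[OF L2(1,2)] that by blast+
    thus ?thesis by eventually_elim (rule antisym)
  qed
  thus ?thesis
    using variation_Union[OF L2(3)] variation_closure[OF assms(5)]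
      nonempty_compacts_has_finite_variation real_variation_continuous_on_compacts
      variation_continuous_away_from_0 variation_continuous_on_cones
      variation_add_le[OF L2(1,2)] variation_mult_independent[OF L2(1,2)]
      variation_elementary_tensors[OF L2(1,2)] variation_tensor_product[OF _ L2(1) _ L2(2)]
    by (intro conjI) blast+
qed

end
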